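(* Let $r,s\in\mathbb{C}^*$ be roots of unity with $r^2\neq s^2$. Let $\lambda=(\lambda_1,\lambda_2,\lambda_3,\lambda_4)$ and $\lambda'=(\lambda_1',\lambda_2',\lambda_3',\lambda_4')$ be elements of $(\mathbb{C}^* )^3\times\mathbb{C}$ with $\lambda_4\neq\frac{s^2(r^2-s^2)}{1-rs^{-1}}\lambda_3$ and $\lambda_4'\neq\frac{s^2(r^2-s^2)}{1-rs^{-1}}\lambda_3'$. Then $\mathcal{M}(\lambda)$ is isomorphic to $\mathcal{M}(\lambda')$ as a $U^+_{r,s}(B_2)$-module if and only if $$\lambda_1^{\ell_1}=s^{-2v\ell_1}(\lambda_1')^{\ell_1},\quad \lambda_2^{m_1}=s^{2um_1}(\lambda_2')^{m_1},\quad \lambda_3=(rs)^{2u}(rs^{-1})^v\lambda_3',$$ $$\lambda_4=(rs)^{2u}\left(\lambda_4'-s^2(r^2-s^2)\frac{1-(rs^{-1})^v}{1-rs^{-1}}\lambda_3'\right)$$ hold for some $0\le u\le\ell_1-1$ and $0\le v\le m_1-1$.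
   Context: $U^+_{r,s}(B_2)$ is the unital associative $\mathbb{C}$-algebra generated by $e_1,e_2$ subject to $$e_1^2 e_2-(r^2+s^2)e_1e_2e_1+r^2s^2e_2e_1^2=0,$$ $$e_1e_2^3-(r^2+rs+s^2)e_2e_1e_2^2+rs(r^2+rs+s^2)e_2^2e_1e_2-r^3s^3e_2^3e_1=0.$$ Put $X_1=e_1$, $X_2=e_1e_2-r^2e_2e_1$, $X_3=e_2X_2-s^{-2}X_2e_2$, $X_4=e_2$. These satisfy $$X_1X_2=s^2X_2X_1,\quad X_1X_3=r^2s^2X_3X_1,\quad X_1X_4=r^2X_4X_1+X_2,$$ $$X_2X_3=rsX_3X_2,\quad X_2X_4=s^2X_4X_2-s^2X_3,\quad X_3X_4=rsX_4X_3,$$ and the monomials $X_1^aX_2^bX_3^cX_4^d$ form a basis. All modules are right modules; $\operatorname{ord}(z)$ is the multiplicative order of $z$. Put $m_1=\operatorname{ord}(rs^{-1})$, and $\ell_1=\operatorname{ord}(r^2s^2)$ if $\operatorname{ord}(s^2)\mid\operatorname{ord}(r^2s^2)\operatorname{ord}(rs^{-1})$, $\ell_1=2\operatorname{ord}(r^2s^2)$ otherwise. $\mathcal{M}(\lambda)$ is the $U^+_{r,s}(B_2)$-module with basis $\{e(a,b): 0\le a\le\ell_1-1,\ 0\le b\le m_1-1\}$ and action ($\oplus$ modulo $\ell_1$) $$e(a,b)X_1=s^{-2b}\lambda_1e(a\oplus1,b),\qquad e(a,b)X_2=\begin{cases}\lambda_2e(a,b+1),&b\neq m_1-1,\\ s^{2am_1}\lambda_2e(a,0),&b=m_1-1,\end{cases}$$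 $$e(a,b)X_3=(rs)^{2a+b}\lambda_1^{-1}\lambda_3e(a\oplus(-1),b),$$ $$e(a,b)X_4=\begin{cases}\frac{1}{\Delta}\left[(rs)^{2a}s^{2(b-1)}T_b\,e(a\oplus(-1),b-1)-s^{2(b+1)}\lambda_1^{-1}\lambda_2\,e(a\oplus(-1),b+1)\right],&b\neq0,m_1-1,\\ \frac1\Delta\left[(rs)^{2a}s^{-2((a-1)m_1+1)}T_0\,e(a\oplus(-1),m_1-1)-s^2\lambda_1^{-1}\lambda_2\,e(a\oplus(-1),1)\right],&b=0,\\ \frac1\Delta\left[(rs)^{2a}s^{2(m_1-2)}T_{m_1-1}\,e(a\oplus(-1),m_1-2)-s^{2am_1}\lambda_1^{-1}\lambda_2\,e(a\oplus(-1),0)\right],&b=m_1-1,\end{cases}$$ where $\Delta=r^2-s^2$ and $T_b=\lambda_1^{-1}\lambda_2^{-1}\left(\lambda_4-s^2\Delta\frac{1-(rs^{-1})^b}{1-rs^{-1}}\lambda_3\right)$. *)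

theory Defs
  imports "HOL-Algebra.Algebra" "HOL-Library.Poly_Mapping" Complex_Main
begin

section \<open>Right modules\<close>

text \<open>
  The library's modules are over commutative rings, so right modules over a
  noncommutative ring are set up here on the library's record for modules.
  The action is written \<open>x \<odot>\<^bsub>M\<^esub> v\<close> with the ring element first, as the record
  prescribes, but stands for \<open>v x\<close>; note the order in the associativity law.
  A right module over a unital \<open>\<complex>\<close>-algebra is a complex vector space
  through the scalars of the algebra, and module homomorphisms are then linear.
\<close>

locale right_module = R?: ring R + M?: abelian_group M
  for R :: "('a, 'k) ring_scheme" (structure) and M :: "('a, 'b, 'm) module_scheme" (structure) +
  assumes act_closed: "\<lbrakk>x \<in> carrier R; v \<in> carrier M\<rbrakk> \<Longrightarrow> x \<odot>\<^bsub>M\<^esub> v \<in> carrier M"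
    and act_add_ring: "\<lbrakk>x \<in> carrier R; y \<in> carrier R; v \<in> carrier M\<rbrakk>
      \<Longrightarrow> (x \<oplus>\<^bsub>R\<^esub> y) \<odot>\<^bsub>M\<^esub> v = x \<odot>\<^bsub>M\<^esub> v \<oplus>\<^bsub>M\<^esub> y \<odot>\<^bsub>M\<^esub> v"
    and act_add_module: "\<lbrakk>x \<in> carrier R; v \<in> carrier M; w \<in> carrier M\<rbrakk>
      \<Longrightarrow> x \<odot>\<^bsub>M\<^esub> (v \<oplus>\<^bsub>M\<^esub> w) = x \<odot>\<^bsub>M\<^esub> v \<oplus>\<^bsub>M\<^esub> x \<odot>\<^bsub>M\<^esub> w"
    and act_mult: "\<lbrakk>x \<in> carrier R; y \<in> carrier R; v \<in> carrier M\<rbrakk>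
      \<Longrightarrow> (x \<otimes>\<^bsub>R\<^esub> y) \<odot>\<^bsub>M\<^esub> v = y \<odot>\<^bsub>M\<^esub> (x \<odot>\<^bsub>M\<^esub> v)"
    and act_one: "v \<in> carrier M \<Longrightarrow> \<one>\<^bsub>R\<^esub> \<odot>\<^bsub>M\<^esub> v = v"

definition right_module_iso ::
    "('a, 'k) ring_scheme \<Rightarrow> ('a, 'b, 'm) module_scheme \<Rightarrow> ('a, 'c, 'n) module_scheme \<Rightarrow> ('b \<Rightarrow> 'c) set"
  where "right_module_iso R M N = {f.
    bij_betw f (carrier M) (carrier N) \<and>
    (\<forall>v\<in>carrier M. \<forall>w\<in>carrier M. f (v \<oplus>\<^bsub>M\<^esub> w) = f v \<oplus>\<^bsub>N\<^esub> f w) \<and>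
    (\<forall>x\<in>carrier R. \<forall>v\<in>carrier M. f (x \<odot>\<^bsub>M\<^esub> v) = x \<odot>\<^bsub>N\<^esub> f v)}"

definition right_module_isomorphic ::
    "('a, 'k) ring_scheme \<Rightarrow> ('a, 'b, 'm) module_scheme \<Rightarrow> ('a, 'c, 'n) module_scheme \<Rightarrow> bool"
  where "right_module_isomorphic R M N \<longleftrightarrow> right_module_iso R M N \<noteq> {}"


section \<open>The algebra\<close>

text \<open>
  The free algebra is the monoid algebra of the free monoid of words, that is, of
  lists under concatenation, written additively to fit \<open>poly_mapping\<close>.
\<close>

datatype gen = E1 | E2

instantiation list :: (type) monoid_add
begin
definition zero_list :: "'a list" where "zero_list = []"
definition plus_list :: "'a list \<Rightarrow> 'a list \<Rightarrow> 'a list" where "plus_list = (@)"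
instance by standard (simp_all add: zero_list_def plus_list_def)
end

type_synonym free_alg = "gen list \<Rightarrow>\<^sub>0 complex"

definition free_ring :: "free_alg ring"
  where "free_ring = \<lparr>carrier = UNIV, monoid.mult = (*), monoid.one = 1, ring.zero = 0, ring.add = (+)\<rparr>"

definition sc :: "complex \<Rightarrow> free_alg" where "sc c = Poly_Mapping.single [] c"
definition e1 :: free_alg where "e1 = Poly_Mapping.single [E1] 1"
definition e2 :: free_alg where "e2 = Poly_Mapping.single [E2] 1"

definition rel1 :: "complex \<Rightarrow> complex \<Rightarrow> free_alg"
  where "rel1 r s = e1^2 * e2 - sc (r^2 + s^2) * e1 * e2 * e1 + sc (r^2 * s^2) * e2 * e1^2"

definition rel2 :: "complex \<Rightarrow> complex \<Rightarrow> free_alg"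
  where "rel2 r s = e1 * e2^3 - sc (r^2 + r * s + s^2) * e2 * e1 * e2^2
    + sc (r * s * (r^2 + r * s + s^2)) * e2^2 * e1 * e2 - sc (r^3 * s^3) * e2^3 * e1"

definition rel_ideal :: "complex \<Rightarrow> complex \<Rightarrow> free_alg set"
  where "rel_ideal r s = genideal free_ring {rel1 r s, rel2 r s}"

definition U_B2 :: "complex \<Rightarrow> complex \<Rightarrow> free_alg set ring"
  where "U_B2 r s = free_ring Quot rel_ideal r s"

definition cls :: "complex \<Rightarrow> complex \<Rightarrow> free_alg \<Rightarrow> free_alg set"
  where "cls r s x = rel_ideal r s +>\<^bsub>free_ring\<^esub> x"

definition X1 :: free_alg where "X1 = e1"
definition X2 :: "complex \<Rightarrow> free_alg" where "X2 r = e1 * e2 - sc (r^2) * e2 * e1"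
definition X3 :: "complex \<Rightarrow> complex \<Rightarrow> free_alg"
  where "X3 r s = e2 * X2 r - sc (s powi (-2)) * X2 r * e2"
definition X4 :: free_alg where "X4 = e2"


section \<open>The modules\<close>

definition root_of_unity :: "complex \<Rightarrow> bool"
  where "root_of_unity z \<longleftrightarrow> (\<exists>n>0. z ^ n = 1)"

text \<open>Meaningful for roots of unity only.\<close>
definition mult_order :: "complex \<Rightarrow> nat"
  where "mult_order z = (LEAST n. n > 0 \<and> z ^ n = 1)"

definition m1 :: "complex \<Rightarrow> complex \<Rightarrow> nat"
  where "m1 r s = mult_order (r * inverse s)"

definition ell1 :: "complex \<Rightarrow> complex \<Rightarrow> nat"
  where "ell1 r s =
    (if mult_order (s^2) dvd mult_order (r^2 * s^2) * mult_order (r * inverse s)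
     then mult_order (r^2 * s^2) else 2 * mult_order (r^2 * s^2))"

text \<open>
  Vectors are finitely supported coefficient functions on the pairs \<open>(a, b)\<close>;
  \<open>bas a b\<close> is the basis vector \<open>e(a, b)\<close>.
\<close>

type_synonym vec = "(nat \<times> nat) \<Rightarrow>\<^sub>0 complex"

definition cmul :: "complex \<Rightarrow> ('p \<Rightarrow>\<^sub>0 complex) \<Rightarrow> ('p \<Rightarrow>\<^sub>0 complex)"
  where "cmul c v = Poly_Mapping.map ((*) c) v"

definition bas :: "nat \<Rightarrow> nat \<Rightarrow> vec" where "bas a b = Poly_Mapping.single (a, b) 1"

text \<open>\<open>lin T\<close> is the linear map sending each basis vector \<open>k\<close> to \<open>T k\<close>.\<close>
definition lin :: "('k \<Rightarrow> ('p \<Rightarrow>\<^sub>0 complex)) \<Rightarrow> ('k \<Rightarrow>\<^sub>0 complex) \<Rightarrow> ('p \<Rightarrow>\<^sub>0 complex)"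
  where "lin T f = (\<Sum>k\<in>Poly_Mapping.keys f. cmul (Poly_Mapping.lookup f k) (T k))"

definition cyc_suc :: "nat \<Rightarrow> nat \<Rightarrow> nat" where "cyc_suc l a = (a + 1) mod l"
definition cyc_pred :: "nat \<Rightarrow> nat \<Rightarrow> nat" where "cyc_pred l a = (a + l - 1) mod l"

definition T_coeff :: "complex \<Rightarrow> complex \<Rightarrow> complex \<Rightarrow> complex \<Rightarrow> complex \<Rightarrow> complex \<Rightarrow> nat \<Rightarrow> complex"
  where "T_coeff r s l1 l2 l3 l4 b = inverse l1 * inverse l2 *
    (l4 - s^2 * (r^2 - s^2) * ((1 - (r * inverse s)^b) / (1 - r * inverse s)) * l3)"

text \<open>The vectors \<open>e(a, b) X\<^sub>i\<close>.\<close>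

definition bas_X1 :: "complex \<Rightarrow> complex \<Rightarrow> complex \<Rightarrow> nat \<Rightarrow> nat \<Rightarrow> vec"
  where "bas_X1 r s l1 a b =
    cmul (s powi (- 2 * int b) * l1) (bas (cyc_suc (ell1 r s) a) b)"

definition bas_X2 :: "complex \<Rightarrow> complex \<Rightarrow> complex \<Rightarrow> nat \<Rightarrow> nat \<Rightarrow> vec"
  where "bas_X2 r s l2 a b =
    (if b \<noteq> m1 r s - 1 then cmul l2 (bas a (b + 1))
     else cmul (s ^ (2 * a * m1 r s) * l2) (bas a 0))"

definition bas_X3 :: "complex \<Rightarrow> complex \<Rightarrow> complex \<Rightarrow> complex \<Rightarrow> nat \<Rightarrow> nat \<Rightarrow> vec"
  where "bas_X3 r s l1 l3 a b =
    cmul ((r * s) ^ (2 * a + b) * inverse l1 * l3) (bas (cyc_pred (ell1 r s) a) b)"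

definition bas_X4 ::
    "complex \<Rightarrow> complex \<Rightarrow> complex \<Rightarrow> complex \<Rightarrow> complex \<Rightarrow> complex \<Rightarrow> nat \<Rightarrow> nat \<Rightarrow> vec"
  where "bas_X4 r s l1 l2 l3 l4 a b =
    (let m = m1 r s; a' = cyc_pred (ell1 r s) a; T = T_coeff r s l1 l2 l3 l4 in
     cmul (1 / (r^2 - s^2))
      (if b = 0 then
         cmul ((r * s) ^ (2 * a) * s powi (- 2 * ((int a - 1) * int m + 1)) * T 0) (bas a' (m - 1))
         - cmul (s^2 * inverse l1 * l2) (bas a' 1)
       else if b = m - 1 then
         cmul ((r * s) ^ (2 * a) * s powi (2 * (int m - 2)) * T (m - 1)) (bas a' (m - 2))
         - cmul (s ^ (2 * a * m) * inverse l1 * l2) (bas a' 0)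
       else
         cmul ((r * s) ^ (2 * a) * s powi (2 * (int b - 1)) * T b) (bas a' (b - 1))
         - cmul (s ^ (2 * (b + 1)) * inverse l1 * l2) (bas a' (b + 1))))"

definition gen_op ::
    "complex \<Rightarrow> complex \<Rightarrow> complex \<Rightarrow> complex \<Rightarrow> complex \<Rightarrow> complex \<Rightarrow> gen \<Rightarrow> vec \<Rightarrow> vec"
  where "gen_op r s l1 l2 l3 l4 g =
    (case g of E1 \<Rightarrow> lin (\<lambda>(a, b). bas_X1 r s l1 a b)
             | E2 \<Rightarrow> lin (\<lambda>(a, b). bas_X4 r s l1 l2 l3 l4 a b))"

text \<open>Right action of the free algebra: the leftmost letter of a word acts first.\<close>
definition free_act :: "(gen \<Rightarrow> vec \<Rightarrow> vec) \<Rightarrow> free_alg \<Rightarrow> vec \<Rightarrow> vec"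
  where "free_act T x v = lin (\<lambda>w. fold T w v) x"

text \<open>
  The module is built from the action of \<open>X\<^sub>1 = e\<^sub>1\<close> and \<open>X\<^sub>4 = e\<^sub>2\<close>.
  A coset acts through any of its representatives.  The theorems \<open>M_B2_right_module\<close>
  and \<open>M_B2_X1\<close> to \<open>M_B2_X4\<close> below show that this is well defined and
  that all four \<open>X\<^sub>i\<close> act by the formulas above.
  The fields \<open>mult\<close> and \<open>one\<close> of the record play no role in a module.
\<close>
definition M_B2 ::
    "complex \<Rightarrow> complex \<Rightarrow> complex \<Rightarrow> complex \<Rightarrow> complex \<Rightarrow> complex \<Rightarrow> (free_alg set, vec) module"
  where "M_B2 r s l1 l2 l3 l4 =
    \<lparr>carrier = {v. Poly_Mapping.keys v \<subseteq> {(a, b). a < ell1 r s \<and> b < m1 r s}},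
     monoid.mult = undefined, monoid.one = undefined, ring.zero = 0, ring.add = (+),
     smult = (\<lambda>x v. the_elem ((\<lambda>p. free_act (gen_op r s l1 l2 l3 l4) p v) ` x))\<rparr>"

section \<open>Well-definedness\<close>

subsection \<open>Linear maps and the action of words\<close>

lemma lookup_cmul [simp]: "Poly_Mapping.lookup (cmul c v) k = c * Poly_Mapping.lookup v k"
  unfolding cmul_def by (transfer) (simp add: when_def)

lemma cmul_simps [simp]:
  "cmul c 0 = 0" "cmul 0 v = 0" "cmul 1 v = v" "cmul c (cmul d v) = cmul (c * d) v"
  by (auto intro!: poly_mapping_eqI simp: lookup_add)

lemma cmul_add: "cmul c (v + w) = cmul c v + cmul c w"
  and add_cmul: "cmul (c + d) v = cmul c v + cmul d v"
  and cmul_diff: "cmul c (v - w) = cmul c v - cmul c w"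
  by (auto intro!: poly_mapping_eqI simp: lookup_add lookup_minus algebra_simps)

lemma cmul_sum: "cmul c (sum f A) = (\<Sum>x\<in>A. cmul c (f x))"
  by (auto intro!: poly_mapping_eqI simp: lookup_sum sum_distrib_left)

lemma cmul_single [simp]: "cmul c (Poly_Mapping.single k d) = Poly_Mapping.single k (c * d)"
  by (auto intro!: poly_mapping_eqI simp: lookup_single when_def)

lemma lin_superset:
  assumes "finite A" "Poly_Mapping.keys f \<subseteq> A"
  shows "lin T f = (\<Sum>k\<in>A. cmul (Poly_Mapping.lookup f k) (T k))"
  unfolding lin_def using assms
  by (intro sum.mono_neutral_left) (auto simp: in_keys_iff)

lemma lin_single [simp]: "lin T (Poly_Mapping.single k c) = cmul c (T k)"
  by (subst lin_superset[of "{k}"]) auto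

lemma lin_add: "lin T (f + g) = lin T f + lin T g"
proof -
  let ?A = "Poly_Mapping.keys f \<union> Poly_Mapping.keys g"
  have "Poly_Mapping.keys (f + g) \<subseteq> ?A" by (rule keys_add)
  then show ?thesis
    by (simp add: lin_superset[of ?A] lookup_add add_cmul sum.distrib)
qed

lemma lin_cmul: "lin T (cmul c f) = cmul c (lin T f)"
proof -
  have "Poly_Mapping.keys (cmul c f) \<subseteq> Poly_Mapping.keys f" by (auto simp: in_keys_iff)
  then show ?thesis
    by (simp add: lin_superset[of "Poly_Mapping.keys f"] cmul_sum)
qed

definition is_lin :: "(('k \<Rightarrow>\<^sub>0 complex) \<Rightarrow> ('p \<Rightarrow>\<^sub>0 complex)) \<Rightarrow> bool"
  where "is_lin F \<longleftrightarrow> (\<forall>v w. F (v + w) = F v + F w) \<and> (\<forall>c v. F (cmul c v) = cmul c (F v))"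

lemma is_lin_lin [intro]: "is_lin (lin T)" by (simp add: is_lin_def lin_add lin_cmul)

lemma is_linD: "is_lin F \<Longrightarrow> F (v + w) = F v + F w" "is_lin F \<Longrightarrow> F (cmul c v) = cmul c (F v)"
  "is_lin F \<Longrightarrow> F 0 = 0" "is_lin F \<Longrightarrow> F (v - w) = F v - F w"
proof -
  assume F: "is_lin F"
  then show "F (v + w) = F v + F w" "F (cmul c v) = cmul c (F v)" by (auto simp: is_lin_def)
  show "F 0 = 0" using F by (metis cmul_simps(2) is_lin_def)
  have "F (v - w) + F w = F v" using F by (metis diff_add_cancel is_lin_def)
  then show "F (v - w) = F v - F w" by (simp add: eq_diff_eq)
qed

lemma is_lin_sum: "is_lin F \<Longrightarrow> F (sum g A) = (\<Sum>x\<in>A. F (g x))"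
  by (induction A rule: infinite_finite_induct) (simp_all add: is_linD[of F])

lemma is_lin_intros:
  "is_lin F \<Longrightarrow> is_lin G \<Longrightarrow> is_lin (\<lambda>v. F v + G v)"
  "is_lin F \<Longrightarrow> is_lin G \<Longrightarrow> is_lin (\<lambda>v. F v - G v)"
  "is_lin F \<Longrightarrow> is_lin (\<lambda>v. cmul c (F v))"
  "is_lin (\<lambda>v. v)"
  by (simp_all add: is_lin_def cmul_add cmul_diff mult.commute)

lemma is_lin_comp: "is_lin F \<Longrightarrow> is_lin G \<Longrightarrow> is_lin (\<lambda>v. F (G v))"
  by (simp add: is_lin_def)

lemma lin_expand: "v = (\<Sum>k\<in>Poly_Mapping.keys v. cmul (Poly_Mapping.lookup v k) (Poly_Mapping.single k 1))"
  by (rule poly_mapping_eqI)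
     (auto simp: lookup_sum lookup_single when_def in_keys_iff)

lemma is_lin_eqI:
  assumes "is_lin F" "is_lin G" "\<And>k. k \<in> A \<Longrightarrow> F (Poly_Mapping.single k 1) = G (Poly_Mapping.single k 1)"
    and "Poly_Mapping.keys v \<subseteq> A"
  shows "F v = G v"
proof -
  have "F (\<Sum>k\<in>Poly_Mapping.keys v. cmul (Poly_Mapping.lookup v k) (Poly_Mapping.single k 1))
      = G (\<Sum>k\<in>Poly_Mapping.keys v. cmul (Poly_Mapping.lookup v k) (Poly_Mapping.single k 1))"
    unfolding is_lin_sum[OF assms(1)] is_lin_sum[OF assms(2)] is_linD(2)[OF assms(1)] is_linD(2)[OF assms(2)]
    using assms(3,4) by (intro sum.cong) auto
  then show ?thesis using lin_expand[of v] by simp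
qed

lemma free_act_single: "free_act T (Poly_Mapping.single w c) v = cmul c (fold T w v)"
  by (simp add: free_act_def)

lemma is_lin_free_act_left: "is_lin (\<lambda>x. free_act T x v)"
  unfolding free_act_def by (rule is_lin_lin)

lemma is_lin_fold: "(\<And>g. is_lin (T g)) \<Longrightarrow> is_lin (fold T w)"
proof (induction w)
  case Nil then show ?case by (simp add: is_lin_def)
next
  case (Cons a w) then show ?case by (simp add: comp_def is_lin_comp)
qed

lemma is_lin_free_act:
  assumes "\<And>g. is_lin (T g)" shows "is_lin (free_act T x)"
proof -
  have "is_lin (fold T w)" for w using assms by (rule is_lin_fold)
  then show ?thesis
    unfolding is_lin_def free_act_def lin_def
    by (auto simp: cmul_add cmul_sum sum.distrib mult.commute intro!: sum.cong)
qed

lemma free_act_mult: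
  assumes T: "\<And>g. is_lin (T g)"
  shows "free_act T (x * y) v = free_act T y (free_act T x v)"
proof -
  have cm: "cmul c x * y = cmul c (x * y)" "x * cmul c y = cmul c (x * y)" for c and x y :: free_alg
  proof -
    have c: "cmul c z = sc c * z" for z :: free_alg
      unfolding cmul_def sc_def by (metis mult_map_scale_conv_mult zero_list_def)
    have cc: "z * sc c = sc c * z" for z :: free_alg
    proof -
      have "is_lin (\<lambda>z::free_alg. z * sc c)" "is_lin (\<lambda>z::free_alg. sc c * z)"
        unfolding is_lin_def c[symmetric]
        by (auto simp: distrib_right cmul_add mult.commute) 
           (auto simp: cmul_def mult_map_scale_conv_mult mult.assoc)
      then show ?thesis
        by (rule is_lin_eqI[where A=UNIV]) (auto simp: sc_def mult_single plus_list_def)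
    qed
    show "cmul c x * y = cmul c (x * y)" by (simp add: c mult.assoc)
    show "x * cmul c y = cmul c (x * y)" by (metis c cc mult.assoc)
  qed
  have one: "free_act T (x * Poly_Mapping.single w 1) v = fold T w (free_act T x v)" for w
  proof (rule is_lin_eqI[where A=UNIV and v=x])
    show "is_lin (\<lambda>x. free_act T (x * Poly_Mapping.single w 1) v)"
      by (auto simp: is_lin_def distrib_right is_linD[OF is_lin_free_act_left] cm)
    show "is_lin (\<lambda>x. fold T w (free_act T x v))"
      by (rule is_lin_comp[of "fold T w"], rule is_lin_fold, rule T, rule is_lin_free_act_left)
  qed (auto simp: mult_single free_act_single plus_list_def)
  show ?thesis
  proof (rule is_lin_eqI[where A=UNIV and v=y])
    show "is_lin (\<lambda>y. free_act T (x * y) v)"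
      by (auto simp: is_lin_def distrib_left is_linD[OF is_lin_free_act_left] cm)
    show "is_lin (\<lambda>y. free_act T y (free_act T x v))" by (rule is_lin_free_act_left)
  qed (auto simp: one free_act_single)
qed

lemma free_act_simps:
  assumes T: "\<And>g. is_lin (T g)"
  shows "free_act T (x + y) v = free_act T x v + free_act T y v"
    "free_act T (x - y) v = free_act T x v - free_act T y v"
    "free_act T 0 v = 0" "free_act T 1 v = v" "free_act T (sc c) v = cmul c v"
    "free_act T e1 v = T E1 v" "free_act T e2 v = T E2 v"
    "free_act T (x * y) v = free_act T y (free_act T x v)"
  by (simp_all add: is_linD[OF is_lin_free_act_left] free_act_mult[OF T])
     (simp_all add: sc_def e1_def e2_def free_act_single flip: single_one, simp add: zero_list_def free_act_single)

subsection \<open>The algebra as a ring\<close>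

lemma ring_free_ring: "ring free_ring"
proof (rule ringI)
  show "abelian_group free_ring"
  proof (rule abelian_groupI)
    show "\<exists>y\<in>carrier free_ring. y \<oplus>\<^bsub>free_ring\<^esub> x = \<zero>\<^bsub>free_ring\<^esub>" for x
      by (rule bexI[of _ "- x"]) (simp_all add: free_ring_def)
  qed (simp_all add: free_ring_def algebra_simps)
  show "monoid free_ring"
    by (rule monoidI) (simp_all add: free_ring_def mult.assoc)
qed (simp_all add: free_ring_def distrib_left distrib_right)

lemma ideal_rel_ideal: "ideal (rel_ideal r s) free_ring"
  unfolding rel_ideal_def by (rule ring.genideal_ideal[OF ring_free_ring]) (simp add: free_ring_def)

lemma ring_U_B2: "ring (U_B2 r s)"
  unfolding U_B2_def by (rule ideal.quotient_is_ring[OF ideal_rel_ideal])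

lemma lin_bas: "lin T (bas a b) = T (a, b)" by (simp add: bas_def)

subsection \<open>The relations hold on the modules\<close>

lemma mult_order:
  assumes "root_of_unity z"
  shows "mult_order z > 0" "z ^ mult_order z = 1"
  using LeastI_ex[OF assms[unfolded root_of_unity_def]] by (auto simp: mult_order_def)

lemma root_of_unity_intros:
  assumes "root_of_unity x"
  shows "root_of_unity (x ^ n)" "root_of_unity (inverse x)"
    "root_of_unity y \<Longrightarrow> root_of_unity (x * y)"
proof -
  obtain k where k: "k > 0" "x ^ k = 1" using assms by (auto simp: root_of_unity_def)
  show "root_of_unity (x ^ n)" unfolding root_of_unity_def
    by (rule exI[of _ k]) (simp add: k power_mult[symmetric] mult.commute[of n k], simp add: power_mult k)
  show "root_of_unity (inverse x)" unfolding root_of_unity_def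
    by (rule exI[of _ k]) (simp add: k power_inverse)
  assume "root_of_unity y"
  then obtain j where j: "j > 0" "y ^ j = 1" by (auto simp: root_of_unity_def)
  show "root_of_unity (x * y)" unfolding root_of_unity_def
    by (rule exI[of _ "k * j"])
       (simp add: j k power_mult_distrib power_mult, simp add: j power_mult[symmetric] mult.commute[of k j], simp add: j power_mult)
qed

context
  fixes r s l1 l2 l3 l4 :: complex
  assumes rs0: "r \<noteq> 0" "s \<noteq> 0" and ru: "root_of_unity r" "root_of_unity s"
    and rs: "r^2 \<noteq> s^2" and l0: "l1 \<noteq> 0" "l2 \<noteq> 0"
begin

private abbreviation (input) "m \<equiv> m1 r s"
private abbreviation (input) "l \<equiv> ell1 r s"

lemma m1_facts: "m \<ge> 2" "r ^ m = s ^ m"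
proof -
  have q: "root_of_unity (r * inverse s)" using ru by (intro root_of_unity_intros)
  note o = mult_order[OF q, folded m1_def]
  show *: "r ^ m = s ^ m" using o(2) rs0 by (simp add: field_simps power_divide)
  have "m \<noteq> 1" using * rs by auto
  then show "m \<ge> 2" using o by linarith
qed

lemma ell1_facts: "l \<ge> 1" "(r * s) ^ (2 * l) = 1" "s ^ (2 * m * l) = 1"
proof -
  let ?o = "mult_order (r^2 * s^2)"
  have "root_of_unity (r^2 * s^2)" using ru by (intro root_of_unity_intros)
  note o = mult_order[OF this]
  have "root_of_unity (s^2)" using ru by (intro root_of_unity_intros)
  note os = mult_order[OF this]
  show "l \<ge> 1" using o(1) by (simp add: ell1_def)
  have o2: "(r * s) ^ (2 * ?o) = 1" using o(2) by (simp add: power_mult power_mult_distrib)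
  have "l = ?o \<or> l = ?o * 2" by (auto simp: ell1_def)
  then show "(r * s) ^ (2 * l) = 1" using o2 by (auto simp: mult.assoc[symmetric] power_mult)
  show "s ^ (2 * m * l) = 1"
  proof (cases "mult_order (s^2) dvd ?o * m")
    case True
    then have "l = ?o" by (simp add: ell1_def m1_def)
    obtain k where "?o * m = mult_order (s^2) * k" using True by (elim dvdE)
    then have "(s^2) ^ (?o * m) = 1" using os(2) by (simp add: power_mult)
    then show ?thesis using \<open>l = ?o\<close> by (simp flip: power_mult add: mult_ac)
  next
    case False
    then have "l = 2 * ?o" by (simp add: ell1_def m1_def)
    have "1 = ((r * s) ^ (2 * ?o)) ^ m" using o2 by simp
    also have "\<dots> = (r ^ m) ^ (2 * ?o) * (s ^ m) ^ (2 * ?o)"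
      by (simp flip: power_mult add: power_mult_distrib mult_ac)
    also have "\<dots> = s ^ (2 * m * (2 * ?o))"
      unfolding m1_facts by (simp flip: power_mult power_add add: algebra_simps)
    finally show ?thesis using \<open>l = 2 * ?o\<close> by simp
  qed
qed

text \<open>
  Extending the basis to all integer indices by
  \<open>e(a + \<ell>\<^sub>1, b) = e(a, b)\<close> and \<open>e(a, b + m\<^sub>1) = s\<^bsup>2am\<^sub>1\<^esup> e(a, b)\<close>
  removes all case distinctions from the action.
\<close>
definition eps :: "int \<Rightarrow> int \<Rightarrow> vec"
  where "eps i j = cmul (s powi (2 * int m * i * (j div int m)))
    (bas (nat (i mod int l)) (nat (j mod int m)))"

lemma s_powi_add: "s powi (p + q) = s powi p * s powi q"
  using rs0 by (simp add: power_int_add)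

lemma s_period: "s powi (2 * int m * (int l * k)) = 1"
proof -
  have "s powi (2 * int m * int l) = 1"
    using ell1_facts(3) by (metis of_nat_mult of_nat_numeral power_int_of_nat)
  then have "(s powi (2 * int m * int l)) powi k = 1" by simp
  then show ?thesis by (simp flip: power_int_mult add: mult_ac)
qed

lemma rs_period: "(r * s) powi (2 * (int l * k)) = 1"
proof -
  have "(r * s) powi (2 * int l) = 1"
    using ell1_facts(2) by (metis of_nat_mult of_nat_numeral power_int_of_nat)
  then have "((r * s) powi (2 * int l)) powi k = 1" by simp
  then show ?thesis by (simp flip: power_int_mult add: mult_ac)
qed

lemma rs_m: "(r * s) powi (int m * k) = s powi (2 * int m * k)"
proof -
  have "(r * s) powi int m = s powi (2 * int m)"
    using m1_facts(2) by (simp add: power_mult_distrib flip: power_mult_distrib mult_2 power_add)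
       (simp add: power_int_mult power_mult_distrib mult.commute power_mult power2_eq_square)
  then have "((r * s) powi int m) powi k = (s powi (2 * int m)) powi k" by simp
  then show ?thesis by (simp only: power_int_mult)
qed

lemma q_m: "(r * inverse s) powi (int m * k) = 1"
proof -
  have "(r * inverse s) powi int m = 1"
    using m1_facts(2) rs0 by (simp add: power_mult_distrib power_inverse)
  then have "((r * inverse s) powi int m) powi k = 1" by simp
  then show ?thesis by (simp only: power_int_mult)
qed

lemma eps_l: "eps (i + int l * k) j = eps i j"
proof -
  have "2 * int m * (i + int l * k) * n = 2 * int m * i * n + 2 * int m * (int l * (k * n))" for n
    by (simp add: algebra_simps)
  then show ?thesis using rs0 by (simp add: eps_def power_int_add s_period)
qed

lemma eps_m: "eps i (j + int m * k) = cmul (s powi (2 * int m * i * k)) (eps i j)"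
proof -
  have "m \<noteq> 0" using m1_facts by auto
  then show ?thesis using rs0 by (simp add: eps_def power_int_add distrib_left mult_ac)
qed

lemma eps_bas: "a < l \<Longrightarrow> b < m \<Longrightarrow> eps (int a) (int b) = bas a b"
  by (simp add: eps_def nat_mod_distrib)

lemma eps_suc: "b < m \<Longrightarrow> bas (cyc_suc l a) b = eps (int a + 1) (int b)"
proof -
  assume b: "b < m"
  have "int (cyc_suc l a) = (int a + 1) mod int l"
    by (simp add: cyc_suc_def zmod_int add.commute)
  then have "nat ((int a + 1) mod int l) = cyc_suc l a" by (metis nat_int)
  then show ?thesis using b by (simp add: eps_def nat_mod_distrib)
qed

lemma eps_pred: "b < m \<Longrightarrow> bas (cyc_pred l a) b = eps (int a - 1) (int b)"
proof -
  assume b: "b < m"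
  have "int (cyc_pred l a) = (int a - 1) mod int l"
    using ell1_facts(1) by (simp add: cyc_pred_def zmod_int of_nat_diff)
       (metis add.commute diff_add_eq mod_add_self2)
  then have "nat ((int a - 1) mod int l) = cyc_pred l a" by (metis nat_int)
  then show ?thesis using b by (simp add: eps_def nat_mod_distrib)
qed

definition Tz :: "int \<Rightarrow> complex"
  where "Tz j = inverse l1 * inverse l2 *
    (l4 - s^2 * (r^2 - s^2) * ((1 - (r * inverse s) powi j) / (1 - r * inverse s)) * l3)"

lemma Tz_T: "T_coeff r s l1 l2 l3 l4 b = Tz (int b)" by (simp add: T_coeff_def Tz_def)

lemma Tz_m: "Tz (j + int m * k) = Tz j"
proof -
  have "(r * inverse s) powi (j + int m * k) = (r * inverse s) powi j"
    using rs0 q_m[of k] by (simp add: power_int_add)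
  then show ?thesis by (simp add: Tz_def)
qed

private abbreviation (input) "G \<equiv> gen_op r s l1 l2 l3 l4"
private abbreviation (input) "G2 \<equiv> lin (\<lambda>(a, b). bas_X2 r s l2 a b)"
private abbreviation (input) "G3 \<equiv> lin (\<lambda>(a, b). bas_X3 r s l1 l3 a b)"

lemma is_lin_G: "is_lin (G g)" by (cases g) (auto simp: gen_op_def)
lemma is_lin_G2: "is_lin G2" by auto
lemma is_lin_G3: "is_lin G3" by auto

definition vecs :: "vec set" where "vecs = {v. Poly_Mapping.keys v \<subseteq> {(a, b). a < l \<and> b < m}}"

lemma index_cases:
  obtains a b k n where "a < l" "b < m" "i = int a + int l * k" "j = int b + int m * n"
proof -
  have "l > 0" "m > 0" using m1_facts ell1_facts by auto
  show ?thesis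
  proof (rule that[of "nat (i mod int l)" "nat (j mod int m)" "i div int l" "j div int m"])
    show "nat (i mod int l) < l" "nat (j mod int m) < m"
      using \<open>l > 0\<close> \<open>m > 0\<close> by (simp_all add: nat_less_iff)
  qed (use \<open>l > 0\<close> \<open>m > 0\<close> in simp_all)
qed

lemma eps_period:
  "eps (int a + int l * k + d) (int b + int m * n + d')
    = cmul (s powi (2 * int m * (int a + d) * n)) (eps (int a + d) (int b + d'))"
proof -
  have *: "int a + int l * k + d = int a + d + int l * k"
    "int b + int m * n + d' = int b + d' + int m * n" by simp_all
  show ?thesis unfolding * eps_m eps_l using rs0 s_period[of "k * n"]
    by (simp add: distrib_left distrib_right power_int_add mult_ac)
qed

lemma G1_eps: "G E1 (eps i j) = cmul (s powi (- 2 * j) * l1) (eps (i + 1) j)"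
proof (rule index_cases[of i j])
  fix a b k n assume ab: "a < l" "b < m" and ij: "i = int a + int l * k" "j = int b + int m * n"
  have *: "G E1 (bas a b) = cmul (s powi (- 2 * int b) * l1) (eps (int a + 1) (int b))"
    using ab by (simp add: gen_op_def lin_bas bas_X1_def eps_suc)
  have e: "2 * int m * (int a + 1) * n = 2 * int m * int a * n + 2 * int m * n"
    "- 2 * int b = - 2 * j + 2 * int m * n" unfolding ij by (simp_all add: algebra_simps)
  have p: "s powi (2 * int m * (int a + 1) * n) = s powi (2 * int m * int a * n) * s powi (2 * int m * n)"
    "s powi (- 2 * int b) = s powi (- 2 * j) * s powi (2 * int m * n)"
    unfolding e by (rule s_powi_add)+
  have E: "eps i j = cmul (s powi (2 * int m * int a * n)) (bas a b)"
    "eps (i + 1) j = cmul (s powi (2 * int m * (int a + 1) * n)) (eps (int a + 1) (int b))"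
    using eps_period[of a k 0 b n 0] eps_period[of a k 1 b n 0] ab by (simp_all add: ij eps_bas)
  show ?thesis unfolding E is_linD(2)[OF is_lin_G] * p cmul_simps by (simp only: mult_ac)
qed

lemma G2_eps: "G2 (eps i j) = cmul l2 (eps i (j + 1))"
proof (rule index_cases[of i j])
  fix a b k n assume ab: "a < l" "b < m" and ij: "i = int a + int l * k" "j = int b + int m * n"
  have *: "G2 (bas a b) = cmul l2 (eps (int a) (int b + 1))"
  proof (cases "b = m - 1")
    case True
    have 1: "s powi (2 * int m * int a) = s ^ (2 * a * m)"
      unfolding power_int_of_nat[symmetric] by (simp only: of_nat_mult of_nat_numeral mult_ac)
    have 2: "eps (int a) (int b + 1) = cmul (s ^ (2 * a * m)) (bas a 0)"
      using eps_m[of "int a" 0 1] eps_bas[of a 0] True ab m1_facts(1) unfolding 1[symmetric] by simp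
    show ?thesis unfolding 2 cmul_simps using True
      by (simp only: lin_bas bas_X2_def prod.case refl not_True_eq_False if_False mult.commute[of l2])
  next
    case False
    then show ?thesis using ab eps_bas[of a "b + 1"] by (simp add: lin_bas bas_X2_def add.commute)
  qed
  have E: "eps i j = cmul (s powi (2 * int m * int a * n)) (bas a b)"
    "eps i (j + 1) = cmul (s powi (2 * int m * int a * n)) (eps (int a) (int b + 1))"
    using eps_period[of a k 0 b n 0] eps_period[of a k 0 b n 1] ab by (simp_all add: ij eps_bas)
  show ?thesis unfolding E is_linD(2)[OF is_lin_G2] * cmul_simps by (simp only: mult_ac)
qed

lemma G3_eps: "G3 (eps i j) = cmul ((r * s) powi (2 * i + j) * inverse l1 * l3) (eps (i - 1) j)"
proof (rule index_cases[of i j])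
  fix a b k n assume ab: "a < l" "b < m" and ij: "i = int a + int l * k" "j = int b + int m * n"
  have "(r * s) ^ (2 * a + b) = (r * s) powi (2 * int a + int b)"
    by (metis of_nat_mult of_nat_add of_nat_numeral power_int_of_nat)
  then have *: "G3 (bas a b) = cmul ((r * s) powi (2 * int a + int b) * inverse l1 * l3) (eps (int a - 1) (int b))"
    using ab by (simp add: lin_bas bas_X3_def eps_pred)
  have "2 * i + j = 2 * int a + int b + 2 * (int l * k) + int m * n" using ij by simp
  then have p: "(r * s) powi (2 * i + j) = (r * s) powi (2 * int a + int b) * s powi (2 * int m * n)"
  proof -
    have add: "(r * s) powi (p + q) = (r * s) powi p * (r * s) powi q" for p q
      using rs0 by (simp add: power_int_add)
    assume *: "2 * i + j = 2 * int a + int b + 2 * (int l * k) + int m * n"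
    show ?thesis unfolding * add rs_period rs_m by simp
  qed
  have e: "2 * int m * int a * n = 2 * int m * n + 2 * int m * (int a - 1) * n" by (simp add: algebra_simps)
  have p': "s powi (2 * int m * int a * n) = s powi (2 * int m * n) * s powi (2 * int m * (int a - 1) * n)"
    unfolding e by (rule s_powi_add)
  have E: "eps i j = cmul (s powi (2 * int m * int a * n)) (bas a b)"
    "eps (i - 1) j = cmul (s powi (2 * int m * (int a - 1) * n)) (eps (int a - 1) (int b))"
    using eps_period[of a k 0 b n 0] eps_period[of a k "-1" b n 0] ab by (simp_all add: ij eps_bas)
  show ?thesis
    unfolding E is_linD(2)[OF is_lin_G3] * p p' cmul_simps by (simp only: mult_ac)
qed

lemma G4_eps: "G E2 (eps i j) = cmul (1 / (r^2 - s^2))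
   (cmul ((r * s) powi (2 * i) * s powi (2 * (j - 1)) * Tz j) (eps (i - 1) (j - 1))
    - cmul (s powi (2 * (j + 1)) * inverse l1 * l2) (eps (i - 1) (j + 1)))"
proof (rule index_cases[of i j])
  fix a b k n assume ab: "a < l" "b < m" and ij: "i = int a + int l * k" "j = int b + int m * n"
  have pw: "x ^ (2 * k) = x powi (2 * int k)" for x :: complex and k
    by (metis of_nat_mult of_nat_numeral power_int_of_nat)
  have cE: "cmul c v = cmul d w" if "w = cmul c' v" "c = d * c'" for c d c' and v w :: vec
    using that by simp
  have *: "G E2 (bas a b) = cmul (1 / (r^2 - s^2))
     (cmul ((r * s) powi (2 * int a) * s powi (2 * (int b - 1)) * Tz (int b)) (eps (int a - 1) (int b - 1))
      - cmul (s powi (2 * (int b + 1)) * inverse l1 * l2) (eps (int a - 1) (int b + 1)))"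
  proof -
    have G: "G E2 (bas a b) = bas_X4 r s l1 l2 l3 l4 a b" by (simp add: gen_op_def lin_bas)
    consider "b = 0" | "b \<noteq> 0" "b = m - 1" | "b \<noteq> 0" "b \<noteq> m - 1" by blast
    then show ?thesis
    proof cases
      case 1
      have m: "int (m - 1) = int m - 1" using m1_facts(1) by simp
      have 11: "eps (int a - 1) (int m - 1) = cmul (s powi (2 * int m * (int a - 1))) (eps (int a - 1) (- 1))"
        using eps_m[of "int a - 1" "-1" 1] by simp
      have e: "- 2 * ((int a - 1) * int m + 1) + 2 * int m * (int a - 1) = - 2" by (simp add: algebra_simps)
      have e': "s powi (- 2 * ((int a - 1) * int m + 1)) * s powi (2 * int m * (int a - 1)) = s powi (- 2)"
        using rs0 by (subst power_int_add[symmetric]) (simp_all only: e, simp)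
      have "(r * s) ^ (2 * a) * s powi (- 2 * ((int a - 1) * int m + 1)) * Tz 0 * s powi (2 * int m * (int a - 1))
          = (r * s) ^ (2 * a) * (s powi (- 2 * ((int a - 1) * int m + 1)) * s powi (2 * int m * (int a - 1))) * Tz 0"
        by (simp only: mult_ac)
      also have "\<dots> = (r * s) powi (2 * int a) * s powi (2 * (0 - 1)) * Tz 0"
        unfolding e' pw by simp
      finally have c: "(r * s) ^ (2 * a) * s powi (- 2 * ((int a - 1) * int m + 1)) * Tz 0 * s powi (2 * int m * (int a - 1))
          = (r * s) powi (2 * int a) * s powi (2 * (0 - 1)) * Tz 0" .
      have m1: "m - 1 < m" "1 < m" using m1_facts(1) by auto
      have s2: "s^2 = s powi (2 * (0 + 1))" by simp
      have 0: "(0::int) - 1 = - 1" "(0::int) + 1 = 1" by simp_all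
      show ?thesis unfolding 1 G[unfolded 1] bas_X4_def Let_def
        by (simp only: refl if_True eps_pred[OF m1(1)] eps_pred[OF m1(2)] m 11 Tz_T of_nat_0 of_nat_1
            cmul_simps c s2[symmetric]) (simp only: 0)
    next
      case 2
      have m: "int (m - 1) = int m - 1" "int (m - 2) = int m - 2" using m1_facts(1) by simp_all
      have 11: "eps (int a - 1) (int m) = cmul (s powi (2 * int m * (int a - 1))) (eps (int a - 1) 0)"
        using eps_m[of "int a - 1" "0" 1] by simp
      have e: "2 * int m + 2 * int m * (int a - 1) = 2 * int (a * m)" by (simp add: algebra_simps)
      have e': "s powi (2 * int m) * s powi (2 * int m * (int a - 1)) = s ^ (2 * (a * m))"
        using rs0 unfolding pw by (subst power_int_add[symmetric]) (simp_all only: e, simp)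
      have m0: "m - 1 \<noteq> 0" "m - 2 < m" "0 < m" using m1_facts(1) by auto
      have b: "int b = int m - 1" using 2 m by simp
      have x4: "bas_X4 r s l1 l2 l3 l4 a b = cmul (1 / (r^2 - s^2))
         (cmul ((r * s) ^ (2 * a) * s powi (2 * (int m - 2)) * Tz (int b)) (eps (int a - 1) (int m - 2))
          - cmul (s ^ (2 * (a * m)) * inverse l1 * l2) (eps (int a - 1) 0))"
        using 2 m0 eps_pred[of "m - 2" a] eps_pred[of 0 a] by (simp add: bas_X4_def Let_def m Tz_T mult.assoc)
      show ?thesis unfolding G x4 e'[symmetric] b pw[of _ a] by (simp add: 11 mult_ac)
    next
      case 3
      have b: "int (b - 1) = int b - 1" "b - 1 < m" "b + 1 < m" using 3 ab by simp_all
      have p: "s ^ (2 * (b + 1)) = s powi (2 * (int b + 1))" unfolding pw by (simp add: add.commute)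
      show ?thesis unfolding G bas_X4_def Let_def using 3
        by (simp only: if_False eps_pred[OF b(2)] eps_pred[OF b(3)] b(1) p pw Tz_T of_nat_add of_nat_1)
    qed
  qed
  have R: "(r * s) powi (2 * i) = (r * s) powi (2 * int a)"
    using rs0 rs_period[of k] by (simp add: ij distrib_left power_int_add)
  have T: "Tz j = Tz (int b)" by (simp add: ij Tz_m)
  have S: "s powi (2 * (j + d)) = s powi (2 * (int b + d)) * s powi (2 * int m * n)" for d
    using rs0 by (subst power_int_add[symmetric]) (simp_all add: ij algebra_simps)
  have S1: "s powi (2 * (j - 1)) = s powi (2 * (int b - 1)) * s powi (2 * int m * n)"
    using S[of "-1"] by simp
  have e: "2 * int m * int a * n = 2 * int m * n + 2 * int m * (int a - 1) * n" by (simp add: algebra_simps)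
  have p': "s powi (2 * int m * int a * n) = s powi (2 * int m * n) * s powi (2 * int m * (int a - 1) * n)"
    unfolding e by (rule s_powi_add)
  have E: "eps i j = cmul (s powi (2 * int m * int a * n)) (bas a b)"
    "eps (i - 1) (j - 1) = cmul (s powi (2 * int m * (int a - 1) * n)) (eps (int a - 1) (int b - 1))"
    "eps (i - 1) (j + 1) = cmul (s powi (2 * int m * (int a - 1) * n)) (eps (int a - 1) (int b + 1))"
    using eps_period[of a k 0 b n 0] eps_period[of a k "-1" b n "-1"] eps_period[of a k "-1" b n 1] ab
    by (simp_all add: ij eps_bas)
  show ?thesis
    unfolding E R T S[of 1] S1 is_linD(2)[OF is_lin_G] * p'
    by (simp only: cmul_diff cmul_simps mult_ac)
qed


text \<open>Invariance of the carrier.\<close>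

lemma C_add: "v \<in> vecs \<Longrightarrow> w \<in> vecs \<Longrightarrow> v + w \<in> vecs"
  using keys_add[of v w] unfolding vecs_def by auto

lemma C_zero: "0 \<in> vecs" by (simp add: vecs_def)

lemma C_cmul: "v \<in> vecs \<Longrightarrow> cmul c v \<in> vecs"
  unfolding vecs_def by (auto simp: in_keys_iff subset_iff)

lemma C_diff: "v \<in> vecs \<Longrightarrow> w \<in> vecs \<Longrightarrow> v - w \<in> vecs"
  using keys_diff[of v w] unfolding vecs_def by auto

lemma C_sum: "(\<And>x. x \<in> A \<Longrightarrow> f x \<in> vecs) \<Longrightarrow> sum f A \<in> vecs"
  by (induction A rule: infinite_finite_induct) (simp_all add: C_zero C_add)

lemma C_eps: "eps i j \<in> vecs"
proof -
  have "l > 0" "m > 0" using m1_facts ell1_facts by auto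
  then have "bas (nat (i mod int l)) (nat (j mod int m)) \<in> vecs"
    by (simp add: vecs_def bas_def nat_less_iff)
  then show ?thesis unfolding eps_def by (rule C_cmul)
qed

lemma eps_induct [consumes 1, case_names eps add cmul zero]:
  assumes "v \<in> vecs" "\<And>i j. P (eps i j)" "\<And>v w. P v \<Longrightarrow> P w \<Longrightarrow> P (v + w)"
    "\<And>c v. P v \<Longrightarrow> P (cmul c v)" "P 0"
  shows "P v"
proof -
  have s: "(\<forall>x\<in>A. P (f x)) \<longrightarrow> P (sum f A)" for f :: "nat \<times> nat \<Rightarrow> vec" and A
    by (induction A rule: infinite_finite_induct) (simp_all add: assms(3,5))
  have "P (\<Sum>k\<in>Poly_Mapping.keys v. cmul (Poly_Mapping.lookup v k) (Poly_Mapping.single k 1))"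
  proof (rule s[rule_format])
    fix k assume k: "k \<in> Poly_Mapping.keys v"
    obtain a b where ab: "k = (a, b)" by (cases k)
    then have "a < l" "b < m" using k assms(1) by (auto simp: vecs_def)
    then have "P (bas a b)" using assms(2)[of "int a" "int b"] by (simp add: eps_bas)
    then show "P (cmul (Poly_Mapping.lookup v k) (Poly_Mapping.single k 1))"
      unfolding ab bas_def by (rule assms(4))
  qed
  then show ?thesis using lin_expand[of v] by simp
qed

lemma C_invariant:
  assumes F: "is_lin F" "\<And>i j. F (eps i j) \<in> vecs" and v: "v \<in> vecs"
  shows "F v \<in> vecs"
  using v
proof (induction rule: eps_induct)
  case (add v w) then show ?case unfolding is_linD(1)[OF F(1)] by (rule C_add)
next
  case (cmul c v) then show ?case unfolding is_linD(2)[OF F(1)] by (rule C_cmul)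
next
  case zero show ?case unfolding is_linD(3)[OF F(1)] by (rule C_zero)
qed (rule F(2))

lemma C_eqI:
  assumes F: "is_lin F" "is_lin F'" "\<And>i j. F (eps i j) = F' (eps i j)" and v: "v \<in> vecs"
  shows "F v = F' v"
  using v
  by (induction rule: eps_induct) (simp_all add: assms(3) is_linD[OF F(1)] is_linD[OF F(2)])

lemma C_G: assumes "v \<in> vecs" shows "G g v \<in> vecs"
proof (rule C_invariant[OF is_lin_G _ assms])
  fix i j show "G g (eps i j) \<in> vecs"
  proof (cases g)
    case E1 show ?thesis unfolding E1 G1_eps by (intro C_cmul C_eps)
  next
    case E2 show ?thesis unfolding E2 G4_eps by (intro C_cmul C_diff C_eps)
  qed
qed

lemma C_G2: "v \<in> vecs \<Longrightarrow> G2 v \<in> vecs"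
  by (rule C_invariant[OF is_lin_G2]) (unfold G2_eps, intro C_cmul C_eps)

lemma Tz_step: "(Tz j - Tz (j + 1)) * (l1 * l2) = s^2 * (r^2 - s^2) * (r * inverse s) powi j * l3"
proof -
  have q: "r * inverse s \<noteq> 1" using rs rs0 by (auto simp: field_simps)
  then have "1 - r * inverse s \<noteq> 0" by auto
  then have "(1 - (r * inverse s) powi (j + 1)) / (1 - r * inverse s)
      - (1 - (r * inverse s) powi j) / (1 - r * inverse s) = (r * inverse s) powi j"
    using rs0 by (simp add: power_int_add divide_simps) (simp add: algebra_simps)
  then have *: "(1 - (r * inverse s) powi (j + 1)) / (1 - r * inverse s)
      = (1 - (r * inverse s) powi j) / (1 - r * inverse s) + (r * inverse s) powi j"
    by (simp add: algebra_simps)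
  have "Tz j - Tz (j + 1) = inverse l1 * inverse l2 * (s^2 * (r^2 - s^2) * (r * inverse s) powi j * l3)"
    unfolding Tz_def * by (simp add: algebra_simps)
  then show ?thesis using l0 by (simp add: divide_inverse[symmetric] field_simps)
qed

lemma Delta0: "r^2 - s^2 \<noteq> 0" using rs by simp

lemma powi2: "x powi (2 * k) = (x powi k)^2" for x :: complex
  using power_int_mult[of x k 2] by (simp add: mult.commute)

lemma powi2_neg: "x powi (- 2 * k) = 1 / (x powi k)^2" for x :: complex
  using powi2[of x "- k"] by (simp add: power_int_minus inverse_eq_divide power_divide)

lemmas lin_rules = is_linD[OF is_lin_G] is_linD[OF is_lin_G2] is_linD[OF is_lin_G3]
lemmas eps_rules = G1_eps G2_eps G3_eps G4_eps

lemma powi_s: "s powi (j + 1) = s powi j * s" "s powi (j - 1) = s powi j / s"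
  "s powi (j + 2) = s powi j * s^2" "s powi (- j) = inverse (s powi j)"
  and powi_rs: "(r * s) powi (j + 1) = (r * s) powi j * (r * s)"
  "(r * s) powi (j - 1) = (r * s) powi j / (r * s)"
  using rs0 by (simp_all add: power_int_add power_int_diff power_int_minus)

lemma X2_arith:
  fixes y t Q S D u v c d :: complex
  assumes "Q \<noteq> 0" "S \<noteq> 0" "c \<noteq> 0" "d \<noteq> 0"
  shows "1 / Q * c * (D * (y^2 * (r^2 * S) * (Q / S) * t * u - Q * S * inverse c * d * v))
        - r^2 * (D * (y^2 * (Q / S) * t * (S / Q * c * u) - Q * S * inverse c * d * (1 / (Q * S) * c * v)))
        = (D * (r^2 - S)) * (d * v)"
  using assms by (simp add: field_simps)

lemma X3_arith:
  fixes y t t' Q S D u v c d :: complex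
  assumes "Q \<noteq> 0" "S \<noteq> 0" "c \<noteq> 0" "d \<noteq> 0"
  shows "D * (y^2 * (Q / S) * t * (d * u) - Q * S * inverse c * d * (d * v))
        - inverse S * (d * (D * (y^2 * Q * t' * u - Q * S * S * inverse c * d * v)))
        = D / S * (Q * y^2 * (t - t') * d) * u"
  using assms by (simp add: field_simps)

lemma X3_arith2: "S \<noteq> 0 \<Longrightarrow> D \<noteq> 0 \<Longrightarrow> 1 / D / S * (S * D * y * z * d / c) = y * z * inverse c * (d::complex)"
  by (cases "c = 0") (simp_all add: field_simps)

lemma X2_op:
  assumes "v \<in> vecs" shows "G E2 (G E1 v) - cmul (r^2) (G E1 (G E2 v)) = G2 v"
proof (rule C_eqI[OF _ is_lin_G2 _ assms])
  show "is_lin (\<lambda>v. G E2 (G E1 v) - cmul (r^2) (G E1 (G E2 v)))"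
    by (simp_all add: is_lin_def lin_rules cmul_add cmul_diff mult_ac)
  fix i j
  define x where "x = s powi j" define y where "y = (r * s) powi i"
  have "x \<noteq> 0" "y \<noteq> 0" using rs0 by (auto simp: x_def y_def)
  have p: "s powi (- 2 * j) = 1 / x^2" "s powi (- 2 * (j - 1)) = s^2 / x^2" "s powi (- 2 * (j + 1)) = 1 / (x^2 * s^2)"
    "s powi (2 * (j - 1)) = x^2 / s^2" "s powi (2 * (j + 1)) = x^2 * s^2"
    "(r * s) powi (2 * i) = y^2" "(r * s) powi (2 * (i + 1)) = y^2 * (r^2 * s^2)"
    unfolding x_def y_def powi2_neg powi2 powi_s powi_rs by (simp_all add: power_divide power_mult_distrib)
  have i: "i + 1 - 1 = i" "i - 1 + 1 = i" by simp_all
  show "G E2 (G E1 (eps i j)) - cmul (r^2) (G E1 (G E2 (eps i j))) = G2 (eps i j)"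
    unfolding eps_rules lin_rules p i
  proof (rule poly_mapping_eqI, goal_cases)
    case (1 k)
    have "1 / (r^2 - s^2) * (r^2 - s^2) = 1" using Delta0 by simp
    then show ?case
      using X2_arith[OF _ _ l0, of "x^2" "s^2" "1 / (r^2 - s^2)"] rs0 \<open>x \<noteq> 0\<close>
      by (simp only: lookup_minus lookup_cmul power_eq_0_iff mult_1 simp_thms)
  qed
qed

lemma X3_op:
  assumes "v \<in> vecs" shows "G2 (G E2 v) - cmul (inverse (s^2)) (G E2 (G2 v)) = G3 v"
proof (rule C_eqI[OF _ is_lin_G3 _ assms])
  show "is_lin (\<lambda>v. G2 (G E2 v) - cmul (inverse (s^2)) (G E2 (G2 v)))"
    by (simp_all add: is_lin_def lin_rules cmul_add cmul_diff mult_ac)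
  fix i j
  define x where "x = s powi j" define y where "y = (r * s) powi i" define z where "z = (r * s) powi j"
  have "x \<noteq> 0" "y \<noteq> 0" using rs0 by (auto simp: x_def y_def)
  have p: "s powi (2 * (j - 1)) = x^2 / s^2" "s powi (2 * (j + 1)) = x^2 * s^2" "s powi (2 * (j + 1 + 1)) = x^2 * s^2 * s^2"
    "s powi (2 * j) = x^2"
    "(r * s) powi (2 * i) = y^2" "(r * s) powi (2 * i + j) = y^2 * z"
    unfolding x_def y_def z_def powi2 powi_s
    using rs0 by (simp_all add: power_divide power_mult_distrib powi2 power_int_add)
  have q: "(r * inverse s) powi j * x^2 = z"
    using rs0 unfolding x_def z_def power_int_mult_distrib power_int_inverse
    by (simp add: power2_eq_square)
  have T: "Tz (j + 1) = Tz j - s^2 * (r^2 - s^2) * (r * inverse s) powi j * l3 / (l1 * l2)"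
    using Tz_step[of j] l0 by (simp add: field_simps)
  have c: "x^2 * y^2 * (Tz j - Tz (j + 1)) * l2 = s^2 * (r^2 - s^2) * y^2 * z * l3 / l1"
    unfolding T q[symmetric] using l0 by (simp add: field_simps)
  have e: "j - 1 + 1 = j" "j + 1 - 1 = j" by simp_all
  show "G2 (G E2 (eps i j)) - cmul (inverse (s^2)) (G E2 (G2 (eps i j))) = G3 (eps i j)"
    unfolding eps_rules lin_rules p e
  proof (rule poly_mapping_eqI, goal_cases)
    case (1 k)
    have "1 / (r^2 - s^2) / s^2 * (s^2 * (r^2 - s^2) * y^2 * z * l3 / l1) = y^2 * z * inverse l1 * l3"
      using X3_arith2[OF _ Delta0] rs0 by simp
    then show ?case
      using X3_arith[OF _ _ l0, of "x^2" "s^2" "1 / (r^2 - s^2)"] rs0 \<open>x \<noteq> 0\<close>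
      by (simp only: lookup_minus lookup_cmul power_eq_0_iff c simp_thms)
  qed
qed

lemma X1X2_op:
  assumes "v \<in> vecs" shows "G2 (G E1 v) = cmul (s^2) (G E1 (G2 v))"
proof (rule C_eqI[OF _ _ _ assms])
  show "is_lin (\<lambda>v. G2 (G E1 v))" "is_lin (\<lambda>v. cmul (s^2) (G E1 (G2 v)))"
    by (simp_all add: is_lin_def lin_rules cmul_add cmul_diff mult_ac)
  fix i j
  have "s powi (- 2 * j) = s^2 * s powi (- 2 * (j + 1))"
    using rs0 by (simp add: power_int_diff power_int_add distrib_left)
  then show "G2 (G E1 (eps i j)) = cmul (s^2) (G E1 (G2 (eps i j)))"
    unfolding eps_rules lin_rules by (simp add: mult_ac)
qed

lemma X3X4_op:
  assumes "v \<in> vecs" shows "G E2 (G3 v) = cmul (r * s) (G3 (G E2 v))"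
proof (rule C_eqI[OF _ _ _ assms])
  show "is_lin (\<lambda>v. G E2 (G3 v))" "is_lin (\<lambda>v. cmul (r * s) (G3 (G E2 v)))"
    by (simp_all add: is_lin_def lin_rules cmul_add cmul_diff mult_ac)
  fix i j
  define y where "y = (r * s) powi i" define z where "z = (r * s) powi j"
  have p: "(r * s) powi (2 * i) = y^2" "(r * s) powi (2 * i + j) = y^2 * z"
    "(r * s) powi (2 * (i - 1)) = y^2 / (r * s)^2"
    "(r * s) powi (2 * (i - 1) + (j - 1)) = y^2 * z / (r * s)^3"
    "(r * s) powi (2 * (i - 1) + (j + 1)) = y^2 * z / (r * s)"
    using rs0 unfolding y_def z_def
    by (simp_all add: power_int_add power_int_diff powi2 power2_eq_square power3_eq_cube distrib_left right_diff_distrib)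
  show "G E2 (G3 (eps i j)) = cmul (r * s) (G3 (G E2 (eps i j)))"
    unfolding eps_rules lin_rules p
    apply (rule poly_mapping_eqI)
    using rs0 l0 Delta0
    by (simp add: lookup_minus) (simp add: field_simps power2_eq_square power3_eq_cube)
qed

private abbreviation (input) "act \<equiv> free_act G"

lemmas act_simps = free_act_simps[of G, OF is_lin_G]

lemma act_X:
  assumes "v \<in> vecs"
  shows "act X1 v = G E1 v" "act (X2 r) v = G2 v" "act (X3 r s) v = G3 v" "act X4 v = G E2 v"
proof -
  show "act X1 v = G E1 v" "act X4 v = G E2 v" by (simp_all add: X1_def X4_def act_simps)
  have X2: "act (X2 r) w = G2 w" if "w \<in> vecs" for w
    using X2_op[OF that] by (simp add: X2_def act_simps is_linD[OF is_lin_G])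
  from X2[OF assms] show "act (X2 r) v = G2 v" .
  have "s powi (- 2) = inverse (s^2)" by (simp add: power_int_minus)
  then show "act (X3 r s) v = G3 v"
    using X3_op[OF assms] assms
    by (simp add: X3_def act_simps X2 C_G C_cmul is_linD[OF is_lin_G2] is_linD[OF is_lin_G])
qed

lemma rel2_arith:
  fixes A A' B B' i :: complex
  assumes "B - r^2 * B' - i * (A - r^2 * B) = (r * s) * (B' - r^2 * A' - i * (B - r^2 * B'))"
    and i: "s^2 * i = 1"
  shows "A - (r^2 + r * s + s^2) * B + r * s * (r^2 + r * s + s^2) * B' - r^3 * s^3 * A' = 0"
proof -
  have "s^2 * (B - r^2 * B' - i * (A - r^2 * B))
      = s^2 * ((r * s) * (B' - r^2 * A' - i * (B - r^2 * B')))" using assms(1) by simp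
  then have "s^2 * (B - r^2 * B') - (s^2 * i) * (A - r^2 * B)
      = (r * s) * (s^2 * (B' - r^2 * A') - (s^2 * i) * (B - r^2 * B'))" by (simp add: algebra_simps)
  then show ?thesis unfolding i by (simp add: algebra_simps power2_eq_square power3_eq_cube)
qed

lemma act_rels:
  assumes v: "v \<in> vecs" shows "act (rel1 r s) v = 0" "act (rel2 r s) v = 0"
proof -
  let ?P = "G E1" and ?Q = "G E2"
  note vecs = v C_G C_G2
  note X2 = X2_op[symmetric]
  have 1: "act (rel1 r s) v = ?Q (?P (?P v)) - cmul (r^2 + s^2) (?P (?Q (?P v)))
      + cmul (r^2 * s^2) (?P (?P (?Q v)))"
    by (simp add: rel1_def power2_eq_square act_simps lin_rules)
  have 2: "?Q (?P (?P v)) - cmul (r^2) (?P (?Q (?P v)))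
      = cmul (s^2) (?P (?Q (?P v))) - cmul (s^2 * r^2) (?P (?P (?Q v)))"
    using X1X2_op[OF v] unfolding X2[OF v] X2[OF C_G[OF v]] by (simp add: lin_rules cmul_diff)
  show "act (rel1 r s) v = 0"
  proof (rule poly_mapping_eqI)
    fix k show "Poly_Mapping.lookup (act (rel1 r s) v) k = Poly_Mapping.lookup 0 k"
      unfolding 1 using arg_cong[OF 2, of "\<lambda>w. Poly_Mapping.lookup w k"]
      by (simp add: lookup_add lookup_minus algebra_simps)
  qed
  have 3: "act (rel2 r s) v = ?Q (?Q (?Q (?P v))) - cmul (r^2 + r * s + s^2) (?Q (?Q (?P (?Q v))))
      + cmul (r * s * (r^2 + r * s + s^2)) (?Q (?P (?Q (?Q v)))) - cmul (r^3 * s^3) (?P (?Q (?Q (?Q v))))"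
    by (simp add: rel2_def power2_eq_square power3_eq_cube act_simps lin_rules)
  have G3: "G3 w = ?Q (?P (?Q w)) - cmul (r^2) (?P (?Q (?Q w)))
      - cmul (inverse (s^2)) (?Q (?Q (?P w)) - cmul (r^2) (?Q (?P (?Q w))))" if "w \<in> vecs" for w
    unfolding X3_op[OF that, symmetric] X2[OF that] X2[OF C_G[OF that]] by (simp add: lin_rules)
  have 4: "?Q (G3 v) = cmul (r * s) (G3 (?Q v))" by (rule X3X4_op[OF v])
  show "act (rel2 r s) v = 0"
  proof (rule poly_mapping_eqI)
    fix k
    define A where "A = Poly_Mapping.lookup (?Q (?Q (?Q (?P v)))) k"
    define B where "B = Poly_Mapping.lookup (?Q (?Q (?P (?Q v)))) k"
    define B' where "B' = Poly_Mapping.lookup (?Q (?P (?Q (?Q v)))) k"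
    define A' where "A' = Poly_Mapping.lookup (?P (?Q (?Q (?Q v)))) k"
    have "B - r^2 * B' - inverse (s^2) * (A - r^2 * B)
        = (r * s) * (B' - r^2 * A' - inverse (s^2) * (B - r^2 * B'))"
      using arg_cong[OF 4, of "\<lambda>w. Poly_Mapping.lookup w k"]
      unfolding G3[OF v] G3[OF C_G[OF v]] A_def B_def A'_def B'_def lin_rules lookup_cmul lookup_minus .
    moreover have "s^2 * inverse (s^2) = 1" using rs0 by simp
    ultimately have "A - (r^2 + r * s + s^2) * B + r * s * (r^2 + r * s + s^2) * B' - r^3 * s^3 * A' = 0"
      by (rule rel2_arith)
    then show "Poly_Mapping.lookup (act (rel2 r s) v) k = Poly_Mapping.lookup 0 k"
      unfolding 3 by (simp add: lookup_add lookup_minus A_def B_def A'_def B'_def)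
  qed
qed

lemma C_act: "v \<in> vecs \<Longrightarrow> act x v \<in> vecs"
proof -
  assume v: "v \<in> vecs"
  have "fold G w v \<in> vecs" for w using v by (induction w arbitrary: v) (auto intro: C_G)
  then show ?thesis unfolding free_act_def lin_def by (intro C_sum C_cmul)
qed

lemma act_ideal:
  assumes "x \<in> rel_ideal r s" "v \<in> vecs" shows "act x v = 0"
proof -
  let ?I = "{x. \<forall>v\<in>vecs. act x v = 0}"
  note z = is_linD(3)[OF is_lin_free_act[of G, OF is_lin_G]]
  have "ideal ?I free_ring"
  proof (rule idealI[OF ring_free_ring])
    show "subgroup ?I (add_monoid free_ring)"
    proof (unfold_locales, goal_cases)
      case (4 x)
      have "inv\<^bsub>add_monoid free_ring\<^esub> x = - x"
        by (rule group.inv_equality[OF abelian_group.a_group[OF ring.is_abelian_group[OF ring_free_ring]]])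
           (simp_all add: free_ring_def)
      then show ?case using 4 act_simps(2)[of 0 x] by (simp add: act_simps(3))
    qed (simp_all add: free_ring_def act_simps)
  qed (simp_all add: free_ring_def act_simps C_act z)
  moreover have "{rel1 r s, rel2 r s} \<subseteq> ?I" using act_rels by auto
  ultimately have "rel_ideal r s \<subseteq> ?I"
    unfolding rel_ideal_def by (rule ring.genideal_minimal[OF ring_free_ring])
  then show ?thesis using assms by auto
qed

lemma cls_carrier: "c \<in> carrier (U_B2 r s) \<longleftrightarrow> (\<exists>x. c = cls r s x)"
  by (auto simp: U_B2_def FactRing_def A_RCOSETS_def' cls_def free_ring_def)

lemma cls_eq: "cls r s x = {h + x | h. h \<in> rel_ideal r s}"
  unfolding cls_def a_r_coset_def' by (auto simp: free_ring_def)

lemma cls_ring: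
  "cls r s x \<oplus>\<^bsub>U_B2 r s\<^esub> cls r s y = cls r s (x + y)"
  "cls r s x \<otimes>\<^bsub>U_B2 r s\<^esub> cls r s y = cls r s (x * y)"
  "\<one>\<^bsub>U_B2 r s\<^esub> = cls r s 1"
proof -
  note h = ideal.rcos_ring_hom[OF ideal_rel_ideal[of r s], folded U_B2_def]
  show "cls r s x \<oplus>\<^bsub>U_B2 r s\<^esub> cls r s y = cls r s (x + y)"
    using ring_hom_add[OF h, of x y] by (simp add: cls_def free_ring_def)
  show "cls r s x \<otimes>\<^bsub>U_B2 r s\<^esub> cls r s y = cls r s (x * y)"
    using ring_hom_mult[OF h, of x y] by (simp add: cls_def free_ring_def)
  show "\<one>\<^bsub>U_B2 r s\<^esub> = cls r s 1"
    using ring_hom_one[OF h] by (simp add: cls_def free_ring_def)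
qed

private abbreviation (input) "M \<equiv> M_B2 r s l1 l2 l3 l4"

lemma M_carrier: "carrier M = vecs" by (simp add: M_B2_def vecs_def)

lemma M_add: "v \<oplus>\<^bsub>M\<^esub> w = v + w" by (simp add: M_B2_def)

lemma M_act: assumes "v \<in> carrier M" shows "cls r s x \<odot>\<^bsub>M\<^esub> v = act x v"
proof -
  have v: "v \<in> vecs" using assms by (simp add: M_carrier)
  have "act y v = act x v" if y: "y \<in> cls r s x" for y
  proof -
    obtain h where "h \<in> rel_ideal r s" "y = h + x"
      using y unfolding cls_eq by blast
    then show ?thesis using act_ideal[OF _ v] by (simp add: act_simps)
  qed
  moreover have "x \<in> cls r s x"
  proof -
    have "\<zero>\<^bsub>free_ring\<^esub> \<in> rel_ideal r s"
      by (rule additive_subgroup.zero_closed[OF ideal.axioms(1)[OF ideal_rel_ideal]])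
    then show ?thesis unfolding cls_eq by (auto simp: free_ring_def intro: exI[of _ 0])
  qed
  ultimately have "(\<lambda>p. act p v) ` cls r s x = {act x v}" by blast
  then show ?thesis by (simp add: M_B2_def)
qed

theorem M_B2_right_module: "right_module (U_B2 r s) M"
proof -
  have "abelian_group M"
  proof (rule abelian_groupI)
    fix x assume "x \<in> carrier M"
    then have "- x \<in> carrier M" "- x \<oplus>\<^bsub>M\<^esub> x = \<zero>\<^bsub>M\<^esub>" by (simp_all add: M_B2_def in_keys_iff subset_iff)
    then show "\<exists>y\<in>carrier M. y \<oplus>\<^bsub>M\<^esub> x = \<zero>\<^bsub>M\<^esub>" by auto
  next
    fix x y assume "x \<in> carrier M" "y \<in> carrier M"
    then show "x \<oplus>\<^bsub>M\<^esub> y \<in> carrier M" using C_add unfolding M_carrier by (simp add: M_B2_def)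
  qed (simp_all add: M_B2_def add_ac)
  moreover have "right_module_axioms (U_B2 r s) M"
  proof (unfold_locales, unfold cls_carrier, safe)
  qed (simp_all add: cls_ring M_act M_carrier C_act act_simps M_add C_add is_linD[OF is_lin_free_act[of G, OF is_lin_G]])
  ultimately show ?thesis by (intro right_module.intro ring_U_B2)
qed

lemma bas_carrier: "a < l \<Longrightarrow> b < m \<Longrightarrow> bas a b \<in> carrier M"
  by (simp add: M_B2_def bas_def)

theorem M_B2_X1: "a < l \<Longrightarrow> b < m \<Longrightarrow> cls r s X1 \<odot>\<^bsub>M\<^esub> bas a b = bas_X1 r s l1 a b"
  and M_B2_X2: "a < l \<Longrightarrow> b < m \<Longrightarrow> cls r s (X2 r) \<odot>\<^bsub>M\<^esub> bas a b = bas_X2 r s l2 a b"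
  and M_B2_X3: "a < l \<Longrightarrow> b < m \<Longrightarrow> cls r s (X3 r s) \<odot>\<^bsub>M\<^esub> bas a b = bas_X3 r s l1 l3 a b"
  and M_B2_X4: "a < l \<Longrightarrow> b < m \<Longrightarrow> cls r s X4 \<odot>\<^bsub>M\<^esub> bas a b = bas_X4 r s l1 l2 l3 l4 a b"
  using bas_carrier[of a b] M_act[of "bas a b"] act_X[of "bas a b"]
  by (simp_all add: M_carrier lin_bas gen_op_def)

end

end

theory Submission
  imports Defs
begin

text \<open>
  The elements \<open>X\<^sub>3 X\<^sub>1\<close>, \<open>((r\<^sup>2 - s\<^sup>2) X\<^sub>4 X\<^sub>1 + X\<^sub>2) X\<^sub>2\<close>, \<open>X\<^sub>1\<close> to the power \<open>\<ell>\<^sub>1\<close> and \<open>X\<^sub>2\<close>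
  to the power \<open>m\<^sub>1\<close> act diagonally on the basis.  An isomorphism maps \<open>e(0, 0)\<close> to a common
  eigenvector with the same four eigenvalues; if \<open>e(u, v)\<close> occurs in that vector, its eigenvalues
  must agree, and these are the four conditions.  Conversely, with the basis extended
  quasi-periodically to integer indices, \<open>e(i, j) \<mapsto> \<alpha>\<^sup>i \<beta>\<^sup>j e(u + i, v + j)\<close> intertwines the two
  actions for \<open>\<alpha> = s\<^bsup>-2v\<^esup> \<lambda>\<^sub>1' / \<lambda>\<^sub>1\<close> and \<open>\<beta> = \<lambda>\<^sub>2' / \<lambda>\<^sub>2\<close>, the conditions on \<open>\<lambda>\<^sub>1\<close> and \<open>\<lambda>\<^sub>2\<close> making it
  well defined.
\<close>

lemma powi_power: "(x powi k) ^ n = x powi (k * int n)" for x :: complex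
  by (simp only: power_int_mult power_int_of_nat)

section \<open>One module: the action on the quasi-periodic vectors \<open>e i j\<close>\<close>

locale B2_module =
  fixes r s l1 l2 l3 l4 :: complex
  assumes rs0: "r \<noteq> 0" "s \<noteq> 0" and ru: "root_of_unity r" "root_of_unity s"
    and rs: "r^2 \<noteq> s^2" and l0: "l1 \<noteq> 0" "l2 \<noteq> 0"
begin

abbreviation "l \<equiv> ell1 r s"
abbreviation "m \<equiv> m1 r s"
abbreviation "V \<equiv> vecs r s"
abbreviation "e \<equiv> eps r s"
abbreviation "G \<equiv> gen_op r s l1 l2 l3 l4"
abbreviation "act \<equiv> free_act G"
abbreviation "M \<equiv> M_B2 r s l1 l2 l3 l4"

lemmas params = rs0 ru rs l0

lemmas is_lin_gen = is_lin_G[OF params, of l3 l4]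
lemmas is_lin_act = is_lin_free_act[of G, OF is_lin_gen]
lemmas act_rules = free_act_simps[of G, OF is_lin_gen] is_linD[OF is_lin_act]
lemmas e_in_V = C_eps[OF params]
lemmas act_in_V = C_act[OF params, where ?l3.0 = l3 and ?l4.0 = l4]

lemma act_e:
  "act X1 (e i j) = cmul (s powi (- 2 * j) * l1) (e (i + 1) j)"
  "act (X2 r) (e i j) = cmul l2 (e i (j + 1))"
  "act (X3 r s) (e i j) = cmul ((r * s) powi (2 * i + j) * inverse l1 * l3) (e (i - 1) j)"
  "act X4 (e i j) = cmul (1 / (r^2 - s^2))
     (cmul ((r * s) powi (2 * i) * s powi (2 * (j - 1)) * Tz r s l1 l2 l3 l4 j) (e (i - 1) (j - 1))
      - cmul (s powi (2 * (j + 1)) * inverse l1 * l2) (e (i - 1) (j + 1)))"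
  unfolding act_X[OF params e_in_V]
  by (rule G1_eps[OF params] G2_eps[OF params] G3_eps[OF params] G4_eps[OF params])+

section \<open>Elements acting diagonally, and their eigenvalues\<close>

lemma act_X1_power: "act (X1 ^ n) (e i j) = cmul ((s powi (- 2 * j) * l1) ^ n) (e (i + int n) j)"
  by (induction n arbitrary: i) (simp_all add: act_rules act_e mult_ac add_ac)

lemma act_X2_power: "act (X2 r ^ n) (e i j) = cmul (l2 ^ n) (e i (j + int n))"
  by (induction n arbitrary: j) (simp_all add: act_rules act_e mult_ac add_ac)

text \<open>\<open>e\<close> has period \<open>l\<close> in its first index, so \<open>l\<close>
  steps of \<open>X1\<close> return to the same vector.\<close>

lemma X1_power_diag: "act (X1 ^ l) (e i j) = cmul (s powi (- 2 * j * int l) * l1 ^ l) (e i j)"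
  using eps_l[OF params, of i 1 j]
  by (simp add: act_X1_power power_mult_distrib powi_power)

text \<open>\<open>m\<close> steps in the second index return only up to the factor
  \<open>s^(2mi)\<close>, and this factor makes the eigenvalue depend on \<open>i\<close>.\<close>

lemma X2_power_diag: "act (X2 r ^ m) (e i j) = cmul (s powi (2 * int m * i) * l2 ^ m) (e i j)"
  using eps_m[OF params, of i j 1] by (simp add: act_X2_power mult_ac)

text \<open>\<open>X3\<close> lowers \<open>i\<close> and \<open>X1\<close> raises it again; the
  factor \<open>s^(-2j)\<close> from \<open>X1\<close> turns \<open>(rs)^j\<close> into
  \<open>(r/s)^j\<close>.\<close>

lemma X3_X1_diag:
  "act (X3 r s * X1) (e i j) = cmul ((r * s) powi (2 * i) * (r * inverse s) powi j * l3) (e i j)"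
proof -
  have "(r * inverse s) powi j * (s powi j)^2 = (r * s) powi j"
    using rs0 unfolding power_int_mult_distrib power_int_inverse by (simp add: power2_eq_square)
  then have "(r * s) powi (2 * i + j) = (r * s) powi (2 * i) * (r * inverse s) powi j * (s powi j)^2"
    using rs0 by (simp add: power_int_add)
  then have "(r * s) powi (2 * i + j) * s powi (- 2 * j) = (r * s) powi (2 * i) * (r * inverse s) powi j"
    unfolding powi2_neg[OF params] using rs0 by simp
  moreover have "act (X3 r s * X1) (e i j)
      = cmul ((r * s) powi (2 * i + j) * s powi (- 2 * j) * (inverse l1 * l1) * l3) (e i j)"
    by (simp add: act_rules act_e mult_ac)
  ultimately show ?thesis using l0 by simp
qed

text \<open>This is \<open>Tz\<close> freed of the factor \<open>1 / (l1 l2)\<close>; of the four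
  parameters only \<open>l3\<close> and \<open>l4\<close> remain, and
  \<open>N 0 = l4\<close>.\<close>

definition N :: "int \<Rightarrow> complex"
  where "N j = l4 - s^2 * (r^2 - s^2) * ((1 - (r * inverse s) powi j) / (1 - r * inverse s)) * l3"

lemma Tz_N: "Tz r s l1 l2 l3 l4 j = N j / (l1 * l2)"
  by (simp add: Tz_def[OF params] N_def field_simps)

text \<open>Factors act from left to right. Applying \<open>X1\<close> after \<open>X4\<close>
  restores \<open>i\<close> and leaves vectors at \<open>j - 1\<close> and \<open>j + 1\<close>;
  adding \<open>X2\<close> cancels the one at \<open>j + 1\<close>, and the last \<open>X2\<close>
  moves \<open>j - 1\<close> back to \<open>j\<close>.\<close>

definition Y :: free_alg where "Y = (sc (r^2 - s^2) * X4 * X1 + X2 r) * X2 r"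

lemma Y_diag: "act Y (e i j) = cmul ((r * s) powi (2 * i) * N j) (e i j)"
proof -
  let ?D = "r^2 - s^2"
  have s: "s powi (2 * k) * s powi (- 2 * k) = 1" for k
    using rs0 by (simp flip: power_int_add)
  have D: "?D \<noteq> 0" using rs by simp
  have "act Y (e i j) = cmul ((r * s) powi (2 * i) * (s powi (2 * (j - 1)) * s powi (- 2 * (j - 1)))
        * (l1 * l2 * Tz r s l1 l2 l3 l4 j)) (e i j)
      - cmul ((s powi (2 * (j + 1)) * s powi (- 2 * (j + 1))) * (inverse l1 * l1) * l2 * l2) (e i (j + 2))
      + cmul (l2 * l2) (e i (j + 2))"
    unfolding Y_def using D by (simp add: act_rules act_e cmul_diff mult_ac add_ac)
  then show ?thesis unfolding s Tz_N using l0 by simp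
qed

text \<open>A diagonal operator multiplies each coefficient by its own diagonal entry, so the
  coefficients at \<open>(a, b)\<close> can be compared and cancelled.\<close>

lemma diag_eigenvalue:
  assumes diag: "\<And>a b. act p (e (int a) (int b)) = cmul (d a b) (e (int a) (int b))"
    and v: "v \<in> V" "act p v = cmul c v" and ab: "Poly_Mapping.lookup v (a, b) \<noteq> 0"
  shows "c = d a b"
proof -
  let ?D = "lin (\<lambda>(a, b). cmul (d a b) (bas a b))"
  have "act p v = ?D v"
  proof (rule is_lin_eqI[OF is_lin_act is_lin_lin])
    show "Poly_Mapping.keys v \<subseteq> {(a, b). a < l \<and> b < m}"
      using v(1) by (simp add: vecs_def[OF params])
    show "act p (Poly_Mapping.single k 1) = ?D (Poly_Mapping.single k 1)"
      if "k \<in> {(a, b). a < l \<and> b < m}" for k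
    proof -
      obtain a b where k: "k = (a, b)" "a < l" "b < m" using \<open>k \<in> _\<close> by blast
      show ?thesis using diag[of a b] unfolding k(1) eps_bas[OF params k(2,3)] bas_def by simp
    qed
  qed
  moreover have "Poly_Mapping.lookup (?D v) (a, b) = d a b * Poly_Mapping.lookup v (a, b)"
  proof -
    have "Poly_Mapping.lookup (cmul (Poly_Mapping.lookup v k) (case k of (a, b) \<Rightarrow> cmul (d a b) (bas a b))) (a, b)
        = (if k = (a, b) then d a b * Poly_Mapping.lookup v (a, b) else 0)" for k
      by (cases k) (simp add: bas_def lookup_single when_def)
    then show ?thesis by (simp add: lin_def lookup_sum in_keys_iff del: lookup_cmul)
  qed
  ultimately have "c * Poly_Mapping.lookup v (a, b) = d a b * Poly_Mapping.lookup v (a, b)"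
    using v(2) by (metis lookup_cmul)
  then show ?thesis using ab by simp
qed

section \<open>Shifting the basis indices\<close>

text \<open>The condition on \<open>\<beta>\<close> matches the quasi-periodicity \<open>e(i, j + m\<^sub>1) = s\<^bsup>2im\<^sub>1\<^esup> e(i, j)\<close>.\<close>

definition shift :: "complex \<Rightarrow> complex \<Rightarrow> int \<Rightarrow> int \<Rightarrow> vec \<Rightarrow> vec"
  where "shift \<alpha> \<beta> u v = lin (\<lambda>(a, b). cmul (\<alpha> powi int a * \<beta> powi int b) (e (u + int a) (v + int b)))"

text \<open>On the basis this is the definition; the conditions on \<open>\<alpha>\<close> and
  \<open>\<beta>\<close> extend it to all integer indices, where the action has no case
  distinctions.\<close>

lemma shift_e:
  assumes "\<alpha> \<noteq> 0" "\<beta> \<noteq> 0" "\<alpha> ^ l = 1" "\<beta> ^ m * s powi (2 * int m * u) = 1"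
  shows "shift \<alpha> \<beta> u v (e i j) = cmul (\<alpha> powi i * \<beta> powi j) (e (u + i) (v + j))"
proof (rule index_cases[OF params, of i j])
  fix a b k n assume ab: "a < l" "b < m" and ij: "i = int a + int l * k" "j = int b + int m * n"
  have "\<alpha> powi (int l * k) = 1" using assms(3) by (simp add: power_int_mult)
  then have \<alpha>: "\<alpha> powi i = \<alpha> powi int a" using assms(1) by (simp add: ij power_int_add)
  \<comment> \<open>Passing from \<open>b\<close> to \<open>b + mn\<close> multiplies
    \<open>e\<close> by \<open>s^(2man)\<close>, but its image by an extra \<open>s^(2mun)\<close>,
    which \<open>\<beta>^(mn)\<close> cancels.\<close>
  have "(\<beta> ^ m * s powi (2 * int m * u)) powi n = 1" by (simp add: assms(4))
  then have "\<beta> powi (int m * n) * s powi (2 * int m * u * n) = 1"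
    by (simp add: power_int_mult_distrib power_int_mult)
  then have \<beta>: "\<beta> powi j * s powi (2 * int m * u * n) = \<beta> powi int b"
    using assms(2) by (simp add: ij power_int_add mult.assoc)
  have e1: "e i j = cmul (s powi (2 * int m * int a * n)) (bas a b)"
    using eps_period[OF params, of a k 0 b n 0] ab by (simp add: ij eps_bas[OF params])
  have e2: "e (u + i) (v + j)
      = cmul (s powi (2 * int m * u * n) * s powi (2 * int m * int a * n)) (e (u + int a) (v + int b))"
    using eps_period[OF params, of a k u b n v] rs0
    by (simp add: ij add_ac distrib_left distrib_right power_int_add mult_ac)
  have "shift \<alpha> \<beta> u v (e i j)
      = cmul (s powi (2 * int m * int a * n) * (\<alpha> powi int a * \<beta> powi int b)) (e (u + int a) (v + int b))"
    by (simp add: shift_def e1 lin_cmul lin_bas)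
  also have "\<dots> = cmul (\<alpha> powi i * \<beta> powi j) (e (u + i) (v + j))"
    unfolding e2 \<alpha> \<beta>[symmetric] by (simp add: mult_ac)
  finally show ?thesis .
qed

lemma is_lin_shift: "is_lin (shift \<alpha> \<beta> u v)" unfolding shift_def by (rule is_lin_lin)

lemma bij_shift:
  assumes \<alpha>\<beta>: "\<alpha> \<noteq> 0" "\<beta> \<noteq> 0" "\<alpha> ^ l = 1" "\<beta> ^ m * s powi (2 * int m * u) = 1"
  shows "bij_betw (shift \<alpha> \<beta> u v) V V"
proof -
  let ?\<phi> = "shift \<alpha> \<beta> u v" and ?\<psi> = "shift (inverse \<alpha>) (inverse \<beta>) (- u) (- v)"
  \<comment> \<open>Shifting forth and back leaves the scalar
    \<open>\<alpha>^(-u) \<beta>^(-v)\<close>, because the second coefficient is taken at shifted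
    indices; \<open>?c\<close> corrects this.\<close>
  let ?c = "\<alpha> powi u * \<beta> powi v"
  have inv: "inverse \<alpha> \<noteq> 0" "inverse \<beta> \<noteq> 0" "inverse \<alpha> ^ l = 1"
    "inverse \<beta> ^ m * s powi (2 * int m * - u) = 1"
    using \<alpha>\<beta> by (simp_all add: power_int_minus power_inverse flip: inverse_mult_distrib)
  have closed: "shift a b u' v' w \<in> V"
    if "a \<noteq> 0" "b \<noteq> 0" "a ^ l = 1" "b ^ m * s powi (2 * int m * u') = 1" "w \<in> V" for a b u' v' w
  proof (rule C_invariant[OF params is_lin_shift _ that(5)])
    show "shift a b u' v' (e i j) \<in> V" for i j
      unfolding shift_e[OF that(1-4)] by (rule C_cmul[OF params e_in_V])
  qed
  have "cmul ?c (?\<psi> (?\<phi> w)) = w" if "w \<in> V" for w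
    using that
  proof (rule C_eqI[OF params, rotated 3])
    show "is_lin (\<lambda>w. cmul ?c (?\<psi> (?\<phi> w)))"
      by (rule is_lin_intros(3)[OF is_lin_comp[OF is_lin_shift is_lin_shift]])
    fix i j
    have "\<alpha> powi i * \<beta> powi j * (inverse \<alpha> powi (u + i) * inverse \<beta> powi (v + j)) * ?c = 1"
      using \<alpha>\<beta> by (simp add: power_int_add power_int_inverse field_simps)
    then show "cmul ?c (?\<psi> (?\<phi> (e i j))) = e i j"
      by (simp add: shift_e[OF \<alpha>\<beta>] shift_e[OF inv] is_linD[OF is_lin_shift] mult_ac)
  qed (rule is_lin_intros(4))
  moreover have "?\<phi> (cmul ?c (?\<psi> w)) = w" if "w \<in> V" for w
    using that
  proof (rule C_eqI[OF params, rotated 3])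
    show "is_lin (\<lambda>w. ?\<phi> (cmul ?c (?\<psi> w)))"
      by (rule is_lin_comp[OF is_lin_shift is_lin_intros(3)[OF is_lin_shift]])
    fix i j
    have "inverse \<alpha> powi i * inverse \<beta> powi j * (\<alpha> powi (i - u) * \<beta> powi (j - v)) * ?c = 1"
      using \<alpha>\<beta> by (simp add: power_int_diff power_int_inverse field_simps)
    then show "?\<phi> (cmul ?c (?\<psi> (e i j))) = e i j"
      by (simp add: shift_e[OF \<alpha>\<beta>] shift_e[OF inv] is_linD[OF is_lin_shift] mult_ac)
  qed (rule is_lin_intros(4))
  ultimately show ?thesis
    using closed[OF \<alpha>\<beta>] closed[OF inv] by (intro bij_betw_byWitness[where f' = "\<lambda>w. cmul ?c (?\<psi> w)"])
      (auto intro!: C_cmul[OF params])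
qed

end

section \<open>Two modules with the same \<open>r\<close> and \<open>s\<close>\<close>

locale B2_module_pair =
  A: B2_module r s l1 l2 l3 l4 + B: B2_module r s l1' l2' l3' l4'
  for r s l1 l2 l3 l4 l1' l2' l3' l4' :: complex
begin

abbreviation "parameters_related u v \<equiv>
  l1 ^ A.l = s powi (- 2 * int v * int A.l) * l1' ^ A.l \<and>
  l2 ^ A.m = s ^ (2 * u * A.m) * l2' ^ A.m \<and>
  l3 = (r * s) ^ (2 * u) * (r * inverse s) ^ v * l3' \<and>
  l4 = (r * s) ^ (2 * u) *
    (l4' - s^2 * (r^2 - s^2) * ((1 - (r * inverse s) ^ v) / (1 - r * inverse s)) * l3')"

text \<open>Both modules share the space \<open>A.V\<close> and the vectors \<open>A.e\<close>,
  which depend on \<open>r\<close> and \<open>s\<close> only. Agreement for single letters passes to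
  words by induction and then to \<open>p\<close> by linearity.\<close>

lemma intertwine_gens:
  assumes F: "is_lin F"
    and gen: "\<And>g i j. F (A.G g (A.e i j)) = B.G g (F (A.e i j))" and w: "w \<in> A.V"
  shows "F (A.act p w) = B.act p (F w)"
proof (rule is_lin_eqI[where A = UNIV and v = p])
  show "is_lin (\<lambda>p. F (A.act p w))" by (rule is_lin_comp[OF F is_lin_free_act_left])
  show "is_lin (\<lambda>p. B.act p (F w))" by (rule is_lin_free_act_left)
  have step: "F (A.G g w) = B.G g (F w)" if "w \<in> A.V" for g w
    by (rule C_eqI[OF A.params is_lin_comp[OF F A.is_lin_gen] is_lin_comp[OF B.is_lin_gen F] gen that])
  have "F (fold A.G xs w) = fold B.G xs (F w)" for xs
    using w by (induction xs arbitrary: w) (simp_all add: step C_G[OF A.params])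
  then show "F (A.act (Poly_Mapping.single k 1) w) = B.act (Poly_Mapping.single k 1) (F w)" for k
    by (simp add: free_act_single)
qed simp

lemma isomorphic_if_related:
  assumes "parameters_related u v"
  shows "right_module_isomorphic (U_B2 r s) A.M B.M"
proof -
  note rs0 = A.rs0 and l0 = A.l0 and l0' = B.l0
  \<comment> \<open>Forced by compatibility with \<open>X1\<close> and \<open>X2\<close>:
    \<open>s^(-2j) l1 \<alpha> = s^(-2(v+j)) l1'\<close> and
    \<open>l2 \<beta> = l2'\<close>.\<close>
  define \<alpha> where "\<alpha> = s powi (- 2 * int v) * l1' / l1"
  define \<beta> where "\<beta> = l2' / l2"
  define F where "F = A.shift \<alpha> \<beta> (int u) (int v)"
  have \<alpha>\<beta>: "\<alpha> \<noteq> 0" "\<beta> \<noteq> 0" using rs0 l0 l0' by (simp_all add: \<alpha>_def \<beta>_def)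
  have "\<alpha> ^ A.l = s powi (- 2 * int v * int A.l) * l1' ^ A.l / l1 ^ A.l"
    unfolding \<alpha>_def power_divide power_mult_distrib powi_power ..
  then have \<alpha>l: "\<alpha> ^ A.l = 1" using assms l0 by (metis divide_self power_not_zero)
  have "s powi (2 * int A.m * int u) = s ^ (2 * u * A.m)"
    unfolding power_int_of_nat[symmetric] by (simp only: of_nat_mult of_nat_numeral mult_ac)
  then have "\<beta> ^ A.m * s powi (2 * int A.m * int u) = (s ^ (2 * u * A.m) * l2' ^ A.m) / l2 ^ A.m"
    by (simp add: \<beta>_def power_divide)
  then have \<beta>m: "\<beta> ^ A.m * s powi (2 * int A.m * int u) = 1"
    using assms l0 by (metis divide_self power_not_zero)
  note F_e = A.shift_e[OF \<alpha>\<beta> \<alpha>l \<beta>m, of "int v", folded F_def]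
  have F: "is_lin F" unfolding F_def by (rule A.is_lin_shift)
  have bij: "bij_betw F A.V A.V" unfolding F_def by (rule A.bij_shift[OF \<alpha>\<beta> \<alpha>l \<beta>m])
  let ?q = "r * inverse s"
  \<comment> \<open>The fourth condition is the case \<open>j = 0\<close>. For other
    \<open>j\<close>, split \<open>(1 - q^(v+j)) / (1 - q)\<close> into
    \<open>(1 - q^v) / (1 - q)\<close> and \<open>q^v (1 - q^j) / (1 - q)\<close>, with
    \<open>q = r/s\<close>; the third condition accounts for the second summand.\<close>
  have N: "A.N j = (r * s) powi (2 * int u) * B.N (int v + j)" for j
  proof -
    have "(r * s) powi (2 * int u) = (r * s) ^ (2 * u)"
      by (metis of_nat_mult of_nat_numeral power_int_of_nat)
    moreover have "?q powi (int v + j) = ?q ^ v * ?q powi j" using rs0 by (simp add: power_int_add)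
    moreover have "l4 = (r * s) ^ (2 * u) * (l4' - s^2 * (r^2 - s^2) * ((1 - ?q ^ v) / (1 - ?q)) * l3')"
      "l3 = (r * s) ^ (2 * u) * ?q ^ v * l3'"
      using assms by blast+
    moreover have "P * (L - S * ((1 - Q) / d) * K) - S * ((1 - R) / d) * (P * Q * K)
        = P * (L - S * ((1 - Q * R) / d) * K)" for P L S Q d K R :: complex
      by (simp add: divide_inverse algebra_simps)
    ultimately show ?thesis unfolding A.N_def B.N_def by metis
  qed
  have "F (A.G g (A.e i j)) = B.G g (F (A.e i j))" for g i j
  proof (cases g)
    case E1
    have \<alpha>_eq: "s powi (- 2 * j) * l1 * \<alpha> = s powi (- 2 * (int v + j)) * l1'"
      using l0 unfolding \<alpha>_def distrib_left s_powi_add[OF A.params] by simp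
    have "s powi (- 2 * j) * l1 * (\<alpha> powi (i + 1) * \<beta> powi j)
        = \<alpha> powi i * \<beta> powi j * (s powi (- 2 * (int v + j)) * l1')"
      unfolding power_int_add_1[OF disjI1[OF \<alpha>\<beta>(1)]] \<alpha>_eq[symmetric] by (simp only: mult_ac)
    then show ?thesis
      unfolding E1 G1_eps[OF A.params] G1_eps[OF B.params] F_e is_linD[OF F] is_linD[OF B.is_lin_gen]
        cmul_simps add.assoc by (simp only:)
  next
    case E2
    let ?\<kappa> = "\<lambda>i j. \<alpha> powi i * \<beta> powi j"
    have \<kappa>: "?\<kappa> (i - 1) (j - 1) = ?\<kappa> i j / (\<alpha> * \<beta>)" "?\<kappa> (i - 1) (j + 1) = ?\<kappa> i j * \<beta> / \<alpha>"
      using \<alpha>\<beta> by (simp_all add: power_int_add power_int_diff)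
    have s2: "s powi (- 2 * int v) \<noteq> 0" "s powi (2 * (int v + k)) = s powi (2 * k) / s powi (- 2 * int v)" for k
      using rs0 by (simp_all add: power_int_minus distrib_left power_int_add field_simps)
    \<comment> \<open>The terms at \<open>j - 1\<close> and \<open>j + 1\<close> are matched
      separately: dividing by \<open>\<alpha> \<beta>\<close> turns \<open>1 / (l1 l2)\<close> into
      \<open>s^(2v) / (l1' l2')\<close>, and multiplying by \<open>\<beta> / \<alpha>\<close> turns
      \<open>l2 / l1\<close> into \<open>s^(2v) l2' / l1'\<close>.\<close>
    have 1: "(r * s) powi (2 * i) * s powi (2 * (j - 1)) * Tz r s l1 l2 l3 l4 j * ?\<kappa> (i - 1) (j - 1)
        = ?\<kappa> i j * ((r * s) powi (2 * (int u + i)) * s powi (2 * (int v + (j - 1)))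
            * Tz r s l1' l2' l3' l4' (int v + j))"
      unfolding A.Tz_N B.Tz_N N \<kappa> s2(2) using rs0 l0 l0' s2(1)
      by (simp add: \<alpha>_def \<beta>_def distrib_left power_int_add field_simps)
    have 2: "s powi (2 * (j + 1)) * inverse l1 * l2 * ?\<kappa> (i - 1) (j + 1)
        = ?\<kappa> i j * (s powi (2 * (int v + (j + 1))) * inverse l1' * l2')"
      unfolding \<kappa> s2(2) using rs0 l0 l0' s2(1) by (simp add: \<alpha>_def \<beta>_def field_simps)
    let ?D = "1 / (r^2 - s^2)"
    have "F (A.G E2 (A.e i j)) = cmul ?D
        (cmul ((r * s) powi (2 * i) * s powi (2 * (j - 1)) * Tz r s l1 l2 l3 l4 j * ?\<kappa> (i - 1) (j - 1))
           (A.e (int u + (i - 1)) (int v + (j - 1)))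
         - cmul (s powi (2 * (j + 1)) * inverse l1 * l2 * ?\<kappa> (i - 1) (j + 1))
           (A.e (int u + (i - 1)) (int v + (j + 1))))"
      unfolding G4_eps[OF A.params] is_linD[OF F] F_e cmul_simps ..
    also have "\<dots> = cmul (?\<kappa> i j) (B.G E2 (A.e (int u + i) (int v + j)))"
      unfolding 1 2 G4_eps[OF B.params] add.assoc add_diff_eq[symmetric]
      by (simp only: cmul_diff cmul_simps mult.left_commute)
    also have "\<dots> = B.G E2 (F (A.e i j))"
      unfolding F_e is_linD[OF B.is_lin_gen] ..
    finally show ?thesis unfolding E2 .
  qed
  note act = intertwine_gens[OF F this]
  have "F \<in> right_module_iso (U_B2 r s) A.M B.M"
    unfolding right_module_iso_def M_carrier[OF A.params] M_carrier[OF B.params]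
      M_add[OF A.params] M_add[OF B.params]
  proof (intro CollectI conjI ballI bij is_linD(1)[OF F])
    fix x w assume "x \<in> carrier (U_B2 r s)" and w: "w \<in> A.V"
    then obtain p where x: "x = cls r s p" using cls_carrier[OF A.params] by blast
    have "F w \<in> A.V" using bij_betwE[OF bij] w by blast
    then show "F (x \<odot>\<^bsub>A.M\<^esub> w) = x \<odot>\<^bsub>B.M\<^esub> F w"
      using M_act[OF A.params, of w] M_act[OF B.params, of "F w"] act[OF w] w
      unfolding x M_carrier[OF A.params] M_carrier[OF B.params] by simp
  qed
  then show ?thesis unfolding right_module_isomorphic_def by blast
qed

lemma related_if_isomorphic:
  assumes "right_module_isomorphic (U_B2 r s) A.M B.M"
  obtains u v where "u < A.l" "v < A.m" "parameters_related u v"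
proof -
  obtain f where f: "f \<in> right_module_iso (U_B2 r s) A.M B.M"
    using assms unfolding right_module_isomorphic_def by blast
  have bij: "bij_betw f A.V A.V" and add: "\<And>w w'. w \<in> A.V \<Longrightarrow> w' \<in> A.V \<Longrightarrow> f (w + w') = f w + f w'"
    using f unfolding right_module_iso_def M_carrier[OF A.params] M_carrier[OF B.params]
      M_add[OF A.params] M_add[OF B.params] by blast+
  have fV: "f w \<in> A.V" if "w \<in> A.V" for w using bij_betwE[OF bij] that by blast
  have act: "f (A.act p w) = B.act p (f w)" if "w \<in> A.V" for p w
  proof -
    have "cls r s p \<in> carrier (U_B2 r s)" using cls_carrier[OF A.params] by blast
    then have "f (cls r s p \<odot>\<^bsub>A.M\<^esub> w) = cls r s p \<odot>\<^bsub>B.M\<^esub> f w"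
      using f that unfolding right_module_iso_def M_carrier[OF A.params] by blast
    then show ?thesis
      using M_act[OF A.params, of w] M_act[OF B.params, of "f w"] that fV[OF that]
      unfolding M_carrier[OF A.params] M_carrier[OF B.params] by simp
  qed
  \<comment> \<open>Isomorphisms are only required to be additive and to commute with the algebra;
    homogeneity comes from the scalars \<open>sc c\<close>.\<close>
  have cmul: "f (cmul c w) = cmul c (f w)" if "w \<in> A.V" for c w
    using act[OF that, of "sc c"] by (simp add: A.act_rules B.act_rules)
  define w where "w = f (A.e 0 0)"
  have wV: "w \<in> A.V" unfolding w_def by (intro fV A.e_in_V)
  have "w \<noteq> 0"
  proof
    assume "w = 0"
    moreover have "f 0 = 0" using add[OF C_zero[OF A.params] C_zero[OF A.params]] by simp
    ultimately have "A.e 0 0 = 0"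
      using inj_onD[OF bij_betw_imp_inj_on[OF bij]] A.e_in_V C_zero[OF A.params] unfolding w_def by metis
    moreover have "A.e 0 0 = bas 0 0"
      using eps_bas[OF A.params, of 0 0] m1_facts(1)[OF A.params] ell1_facts(1)[OF A.params] by simp
    moreover have "Poly_Mapping.lookup (bas 0 0) (0, 0) = 1" by (simp add: bas_def)
    ultimately show False by simp
  qed
  \<comment> \<open>A single nonzero coefficient gives all four conditions with the same
    \<open>u\<close> and \<open>v\<close>.\<close>
  then obtain u v where uv: "Poly_Mapping.lookup w (u, v) \<noteq> 0"
    by (metis lookup_zero poly_mapping_eqI surj_pair)
  then have "(u, v) \<in> Poly_Mapping.keys w" by (simp add: in_keys_iff)
  then have lt: "u < A.l" "v < A.m" using wV by (auto simp: vecs_def[OF A.params])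
  have eig: "c = d u v" if "A.act p (A.e 0 0) = cmul c (A.e 0 0)"
    "\<And>a b. B.act p (A.e (int a) (int b)) = cmul (d a b) (A.e (int a) (int b))" for p c d
  proof (rule B.diag_eigenvalue[OF that(2) wV _ uv])
    show "B.act p w = cmul c w"
      unfolding w_def act[OF A.e_in_V, symmetric] that(1) by (rule cmul[OF A.e_in_V])
  qed
  have pw: "x ^ (2 * k) = x powi (2 * int k)" for x :: complex and k
    by (metis of_nat_mult of_nat_numeral power_int_of_nat)
  have "l1 ^ A.l = s powi (- 2 * int v * int A.l) * l1' ^ A.l"
    using eig[OF A.X1_power_diag B.X1_power_diag] by simp
  moreover have "l2 ^ A.m = s ^ (2 * u * A.m) * l2' ^ A.m"
  proof -
    have "s powi (2 * int A.m * int u) = s ^ (2 * u * A.m)"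
      unfolding power_int_of_nat[symmetric] by (simp only: of_nat_mult of_nat_numeral mult_ac)
    then show ?thesis using eig[OF A.X2_power_diag B.X2_power_diag] by simp
  qed
  moreover have "l3 = (r * s) ^ (2 * u) * (r * inverse s) ^ v * l3'"
    using eig[OF A.X3_X1_diag B.X3_X1_diag] unfolding pw by simp
  moreover have "l4 = (r * s) ^ (2 * u) *
      (l4' - s^2 * (r^2 - s^2) * ((1 - (r * inverse s) ^ v) / (1 - r * inverse s)) * l3')"
    using eig[OF A.Y_diag B.Y_diag[unfolded B.Y_def, folded A.Y_def]] unfolding pw A.N_def B.N_def by simp
  ultimately show ?thesis using lt that by blast
qed

end

theorem theorem10p1:
  fixes r s l1 l2 l3 l4 l1' l2' l3' l4' :: complex
  assumes "r \<noteq> 0" "s \<noteq> 0" "root_of_unity r" "root_of_unity s" "r^2 \<noteq> s^2"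
    and "l1 \<noteq> 0" "l2 \<noteq> 0" "l3 \<noteq> 0" "l1' \<noteq> 0" "l2' \<noteq> 0" "l3' \<noteq> 0"
    and "l4 \<noteq> (s^2 * (r^2 - s^2)) / (1 - r * inverse s) * l3"
    and "l4' \<noteq> (s^2 * (r^2 - s^2)) / (1 - r * inverse s) * l3'"
  shows "right_module_isomorphic (U_B2 r s) (M_B2 r s l1 l2 l3 l4) (M_B2 r s l1' l2' l3' l4')
    \<longleftrightarrow> (\<exists>u v. u \<le> ell1 r s - 1 \<and> v \<le> m1 r s - 1 \<and>
          l1 ^ ell1 r s = s powi (- 2 * int v * int (ell1 r s)) * l1' ^ ell1 r s \<and>
          l2 ^ m1 r s = s ^ (2 * u * m1 r s) * l2' ^ m1 r s \<and>
          l3 = (r * s) ^ (2 * u) * (r * inverse s) ^ v * l3' \<and>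
          l4 = (r * s) ^ (2 * u) *
            (l4' - s^2 * (r^2 - s^2) * ((1 - (r * inverse s) ^ v) / (1 - r * inverse s)) * l3'))"
proof -
  interpret B2_module_pair r s l1 l2 l3 l4 l1' l2' l3' l4'
    using assms(1-10) by unfold_locales
  \<comment> \<open>Subtraction is truncated on naturals, so this uses that \<open>A.l\<close> and
    \<open>A.m\<close> are positive.\<close>
  have "u \<le> A.l - 1 \<longleftrightarrow> u < A.l" "v \<le> A.m - 1 \<longleftrightarrow> v < A.m" for u v
    using ell1_facts(1)[OF A.params] m1_facts(1)[OF A.params] by auto
  then show ?thesis using isomorphic_if_related related_if_isomorphic by metis
qed

end
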